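(* \textsc{$c$-Closed Vertex Deletion} can be solved in $f(\mathrm{nd}(G))\cdot n^{\mathcal{O}(1)}$ time for some computable function $f$, where $n$ is the number of vertices of the input graph $G$ and $\mathrm{nd}(G)$ is its neighborhood diversity.
   Context: A graph is $c$-closed if every pair of distinct nonadjacent vertices has at most $c-1$ common neighbors. \textsc{$c$-Closed Vertex Deletion}: given a graph $G=(V,E)$ and a positive integer $k$, decide whether there is $S\subseteq V$ with $|S|\le k$ such that $G-S$ is $c$-closed. The neighborhood diversity $\mathrm{nd}(G)$ is the number of equivalence classes of the relation $u\sim v \iff N(u)\setminus\{v\}=N(v)\setminus\{u\}$ on $V(G)$. *)

theory Defs
  imports Main
begin

section \<open>Finite simple graphs\<close>

record 'a ugraph =
  verts :: "'a set"
  edges :: "'a set set"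

definition simple_graph :: "'a ugraph \<Rightarrow> bool" where
  "simple_graph G \<longleftrightarrow> finite (verts G) \<and>
     edges G \<subseteq> {{u, v} | u v. u \<in> verts G \<and> v \<in> verts G \<and> u \<noteq> v}"

definition nbhd :: "'a ugraph \<Rightarrow> 'a \<Rightarrow> 'a set" where
  "nbhd G v = {u \<in> verts G. {u, v} \<in> edges G}"

definition delete_verts :: "'a ugraph \<Rightarrow> 'a set \<Rightarrow> 'a ugraph" where
  "delete_verts G S = \<lparr>verts = verts G - S, edges = {e \<in> edges G. e \<inter> S = {}}\<rparr>"

text \<open>For \<open>c = 0\<close> the truncated subtraction makes this coincide with \<open>c = 1\<close>;
  it is only meant for \<open>c \<ge> 1\<close>.\<close>

definition c_closed :: "nat \<Rightarrow> 'a ugraph \<Rightarrow> bool" where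
  "c_closed c G \<longleftrightarrow>
     (\<forall>u\<in>verts G. \<forall>v\<in>verts G. u \<noteq> v \<and> {u, v} \<notin> edges G \<longrightarrow>
        card (nbhd G u \<inter> nbhd G v) \<le> c - 1)"

definition c_closed_vertex_deletion :: "nat \<Rightarrow> 'a ugraph \<Rightarrow> nat \<Rightarrow> bool" where
  "c_closed_vertex_deletion c G k \<longleftrightarrow>
     (\<exists>S \<subseteq> verts G. card S \<le> k \<and> c_closed c (delete_verts G S))"

definition same_type :: "'a ugraph \<Rightarrow> ('a \<times> 'a) set" where
  "same_type G = {(u, v). u \<in> verts G \<and> v \<in> verts G \<and> nbhd G u - {v} = nbhd G v - {u}}"

definition nd :: "'a ugraph \<Rightarrow> nat" where
  "nd G = card (verts G // same_type G)"

lemma equiv_same_type: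
  assumes "simple_graph G"
  shows "equiv (verts G) (same_type G)"
proof -
  have sym_nb: "x \<in> nbhd G y \<longleftrightarrow> y \<in> nbhd G x" if "x \<in> verts G" "y \<in> verts G" for x y
    using that by (auto simp: nbhd_def insert_commute)
  have in_V: "nbhd G x \<subseteq> verts G" for x
    by (auto simp: nbhd_def)
  have tr: "nbhd G x - {z} \<subseteq> nbhd G z - {x}"
    if V: "x \<in> verts G" "y \<in> verts G" "z \<in> verts G"
      and xy: "nbhd G x - {y} = nbhd G y - {x}" and yz: "nbhd G y - {z} = nbhd G z - {y}"
    for x y z
  proof
    fix w
    assume w: "w \<in> nbhd G x - {z}"
    have irr: "x \<notin> nbhd G x" if "x \<in> verts G" for x
      using assms by (auto simp: nbhd_def simple_graph_def)
    have "w \<noteq> x" using w irr V by auto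
    show "w \<in> nbhd G z - {x}"
    proof (cases "w = y")
      case False
      then have "w \<in> nbhd G y - {z}" using w xy by blast
      then show ?thesis using yz \<open>w \<noteq> x\<close> by blast
    next
      case True
      show ?thesis
      proof (cases "z = x")
        case True
        then show ?thesis using w \<open>w \<noteq> x\<close> by auto
      next
        case False
        have "x \<in> nbhd G y" using w True V sym_nb by auto
        then have "x \<in> nbhd G z" using yz False True \<open>w \<noteq> x\<close> by blast
        then have "z \<in> nbhd G x" using V sym_nb by blast
        then have "z \<in> nbhd G y" using xy True w by blast
        then show ?thesis using True \<open>w \<noteq> x\<close> V sym_nb by blast
      qed
    qed
  qed
  have "trans (same_type G)"
  proof (rule transI)
    fix x y z
    assume "(x, y) \<in> same_type G" "(y, z) \<in> same_type G"
    then show "(x, z) \<in> same_type G"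
      using tr[of x y z] tr[of z y x] unfolding same_type_def by auto
  qed
  then show ?thesis
    by (auto simp: equiv_def refl_on_def sym_def same_type_def)
qed


section \<open>Random access machines with unit costs\<close>

text \<open>A program uses finitely many registers and an unbounded memory, all holding natural
  numbers. Since the only arithmetic operations are addition and truncated subtraction, numbers
  gain at most one bit per step, so unit-cost time is polynomially related to Turing machine
  time.\<close>

type_synonym reg = nat

record ram_state =
  regs :: "reg \<Rightarrow> nat"
  mem :: "nat \<Rightarrow> nat"

datatype instr =
    Const reg nat
  | Add reg reg reg
  | Sub reg reg reg
  | Load reg reg
  | Store reg reg

fun step :: "instr \<Rightarrow> ram_state \<Rightarrow> ram_state" where
  "step (Const i a) s = s\<lparr>regs := (regs s)(i := a)\<rparr>"
| "step (Add i j l) s = s\<lparr>regs := (regs s)(i := regs s j + regs s l)\<rparr>"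
| "step (Sub i j l) s = s\<lparr>regs := (regs s)(i := regs s j - regs s l)\<rparr>"
| "step (Load i j) s = s\<lparr>regs := (regs s)(i := mem s (regs s j))\<rparr>"
| "step (Store i j) s = s\<lparr>mem := (mem s)(regs s i := regs s j)\<rparr>"

datatype prog =
    Instr instr
  | Seq prog prog
  | IfNZ reg prog prog
  | WhileNZ reg prog

text \<open>\<open>exec P s t s'\<close>: started in state \<open>s\<close>, program \<open>P\<close> halts after exactly \<open>t\<close> steps in state
  \<open>s'\<close>. Every instruction and every evaluation of a branch or loop condition is one step.\<close>

inductive exec :: "prog \<Rightarrow> ram_state \<Rightarrow> nat \<Rightarrow> ram_state \<Rightarrow> bool" where
  Instr: "exec (Instr a) s 1 (step a s)"
| Seq: "exec P s t s' \<Longrightarrow> exec Q s' u s'' \<Longrightarrow> exec (Seq P Q) s (t + u) s''"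
| IfTrue: "regs s i \<noteq> 0 \<Longrightarrow> exec P s t s' \<Longrightarrow> exec (IfNZ i P Q) s (t + 1) s'"
| IfFalse: "regs s i = 0 \<Longrightarrow> exec Q s t s' \<Longrightarrow> exec (IfNZ i P Q) s (t + 1) s'"
| WhileFalse: "regs s i = 0 \<Longrightarrow> exec (WhileNZ i P) s 1 s"
| WhileTrue: "regs s i \<noteq> 0 \<Longrightarrow> exec P s t s' \<Longrightarrow> exec (WhileNZ i P) s' u s'' \<Longrightarrow>
    exec (WhileNZ i P) s (t + u + 1) s''"

inductive_cases exec_InstrE: "exec (Instr a) s t s'"
  and exec_SeqE: "exec (Seq P Q) s t s'"
  and exec_IfNZE: "exec (IfNZ i P Q) s t s'"
  and exec_WhileNZE: "exec (WhileNZ i P) s t s'"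

lemma exec_deterministic:
  "exec P s t s' \<Longrightarrow> exec P s u s'' \<Longrightarrow> t = u \<and> s' = s''"
proof (induction arbitrary: u s'' rule: exec.induct)
  case Instr
  then show ?case by (auto elim: exec_InstrE)
next
  case (Seq P s t1 s1 Q t2 s2)
  obtain u1 r1 u2 where u: "u = u1 + u2" "exec P s u1 r1" "exec Q r1 u2 s''"
    using Seq.prems by (rule exec_SeqE)
  have "t1 = u1" "s1 = r1" using Seq.IH(1)[OF u(2)] by simp_all
  then show ?case using u Seq.IH(2)[of u2 s''] by simp
next
  case (IfTrue s i P t s' Q)
  obtain v where v: "u = Suc v" "exec P s v s''"
    using IfTrue.prems by (rule exec_IfNZE) (use IfTrue.hyps in simp_all)
  then show ?case using IfTrue.IH[OF v(2)] by simp
next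
  case (IfFalse s i Q t s' P)
  obtain v where v: "u = Suc v" "exec Q s v s''"
    using IfFalse.prems by (rule exec_IfNZE) (use IfFalse.hyps in simp_all)
  then show ?case using IfFalse.IH[OF v(2)] by simp
next
  case (WhileFalse s i P)
  show ?case using WhileFalse.prems by (rule exec_WhileNZE) (use WhileFalse.hyps in simp_all)
next
  case (WhileTrue s i P t1 s1 t2 s2)
  obtain u1 r1 u2 where u: "u = Suc (u1 + u2)" "exec P s u1 r1" "exec (WhileNZ i P) r1 u2 s''"
    using WhileTrue.prems by (rule exec_WhileNZE) (use WhileTrue.hyps in simp_all)
  have "t1 = u1" "s1 = r1" using WhileTrue.IH(1)[OF u(2)] by simp_all
  then show ?case using u WhileTrue.IH(2)[of u2 s''] by simp
qed

definition computable :: "(nat \<Rightarrow> nat) \<Rightarrow> bool" where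
  "computable f \<longleftrightarrow>
     (\<exists>P. \<forall>x. \<exists>t s'. exec P \<lparr>regs = (\<lambda>_. 0)(0 := x), mem = (\<lambda>_. 0)\<rparr> t s' \<and> regs s' 0 = f x)"


section \<open>Solving c-Closed Vertex Deletion\<close>

text \<open>An input graph has vertex set \<open>{..<n}\<close>. Register 0 holds \<open>n\<close>, register 1 holds \<open>k\<close>, and the
  first \<open>n * n\<close> memory cells hold the adjacency matrix row by row; all other registers and cells
  are 0. The answer is expected in register 0, as 1 for yes and 0 for no.\<close>

definition input_state :: "nat ugraph \<Rightarrow> nat \<Rightarrow> ram_state" where
  "input_state G k =
     (let n = card (verts G) in
      \<lparr>regs = (\<lambda>_. 0)(0 := n, 1 := k),
       mem = (\<lambda>a. if a < n * n \<and> {a div n, a mod n} \<in> edges G then 1 else 0)\<rparr>)"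

definition solves_CVD_within :: "nat \<Rightarrow> prog \<Rightarrow> (nat ugraph \<Rightarrow> nat) \<Rightarrow> bool" where
  "solves_CVD_within c P T \<longleftrightarrow>
     (\<forall>G k. simple_graph G \<and> verts G = {..<card (verts G)} \<and> k \<ge> 1 \<longrightarrow>
        (\<exists>t s'. exec P (input_state G k) t s' \<and> t \<le> T G \<and>
           regs s' 0 = (if c_closed_vertex_deletion c G k then 1 else 0)))"

end

theory Submission
  imports Defs "HOL-Library.Multiset"
begin

text \<open>A deletion set matters only through the number \<open>y r\<close> of vertices kept in each twin class \<open>r\<close>:
  the common neighbourhood of two nonadjacent vertices is a union of twin classes that depends only
  on the classes of the two vertices. Once the pattern \<open>min (y r) 2\<close> is fixed, closedness therefore
  amounts to upper bounds on subset sums of \<open>y\<close>. If \<open>y\<close> and a better \<open>y'\<close> satisfy these bounds,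
  \<open>y' - y\<close> is a sum of integer vectors that agree in sign in all subset sums and
  whose norm depends only on the number of classes. Adding one of them to \<open>y\<close>
  keeps every subset sum between those of \<open>y\<close> and \<open>y'\<close>, so some bounded move improves \<open>y\<close>.
  Hence local search from every pattern, with \<open>n + 1\<close> passes over all bounded moves, finds an
  optimal solution.\<close>

section \<open>A loop language on top of the random access machine\<close>

text \<open>The task is an integer program with one variable for each of the p classes. Enumerating
  the vectors \<open>y\<close> directly takes about n^p candidates, so what is enumerated has to be
  bounded in p alone, and moves are. Truncation at 2 suffices because a constraint comes from a pair
  of distinct vertices: it is present as soon as both classes survive or, if the two classes
  coincide, as soon as two vertices survive in that class. The bound on the moves arises by treating
  the 2^p subset sums one by one. Making one more sum agree in sign merges at most 2B vectors of
  norm at most B, so B becomes 2B^2; starting from unit vectors, m sums lead to 2^(2^m - 1), which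
  explains the tower 2^2^2^p. The argument sees only which sums occur and not their upper bounds, so
  nothing in the time bound depends on c. Moves and patterns are both written as strings of p
  digits, so that a single counter range and a single decoder serve for both.\<close>

text \<open>Programs are written with unaliased arrays; array \<open>a < 8\<close> lives interleaved in the cells
  \<open>B + 8 * i + a\<close>, where \<open>B\<close> is the content of register 3. Cells below \<open>B\<close> are the
  read-only input. Registers from 30 on are temporaries of the compiler.\<close>

record st =
  vr :: "nat \<Rightarrow> nat"
  ar :: "nat \<Rightarrow> nat \<Rightarrow> nat"
  inp :: "nat \<Rightarrow> nat"

datatype exp = Cn nat | V nat | Pl exp exp | Mi exp exp | Ld nat exp | In exp

fun eval :: "exp \<Rightarrow> st \<Rightarrow> nat" where
  "eval (Cn k) s = k"
| "eval (V x) s = vr s x"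
| "eval (Pl a b) s = eval a s + eval b s"
| "eval (Mi a b) s = eval a s - eval b s"
| "eval (Ld a e) s = ar s a (eval e s)"
| "eval (In e) s = inp s (eval e s)"

datatype com = Asg nat exp | St nat exp exp | Sq com com | Cond exp com com | For nat nat com | Skip

abbreviation set_var :: "nat \<Rightarrow> nat \<Rightarrow> st \<Rightarrow> st" where
  "set_var x k s \<equiv> s\<lparr>vr := (vr s)(x := k)\<rparr>"

text \<open>The counter is overwritten with \<open>Suc j\<close> rather than incremented, so that
  after j rounds it is j by definition. The compiled loop increments it; the two agree because
  \<open>ok\<close> forbids the body to assign the counter.\<close>

primrec iter :: "nat \<Rightarrow> (st \<Rightarrow> st) \<Rightarrow> nat \<Rightarrow> st \<Rightarrow> st" where
  "iter x f 0 s = set_var x 0 s"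
| "iter x f (Suc j) s = set_var x (Suc j) (f (iter x f j s))"

fun exe :: "com \<Rightarrow> st \<Rightarrow> st" where
  "exe (Asg x e) s = set_var x (eval e s) s"
| "exe (St a i e) s = s\<lparr>ar := (ar s)(a := (ar s a)(eval i s := eval e s))\<rparr>"
| "exe (Sq c d) s = exe d (exe c s)"
| "exe (Cond e c d) s = (if eval e s \<noteq> 0 then exe c s else exe d s)"
| "exe (For x r c) s = iter x (exe c) (vr s r) s"
| "exe Skip s = s"

fun asg :: "com \<Rightarrow> nat list" where
  "asg (Asg x e) = [x]"
| "asg (St a i e) = []"
| "asg (Sq c d) = asg c @ asg d"
| "asg (Cond e c d) = asg c @ asg d"
| "asg (For x r c) = x # asg c"
| "asg Skip = []"

fun sto :: "com \<Rightarrow> nat list" where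
  "sto (Asg x e) = []"
| "sto (St a i e) = [a]"
| "sto (Sq c d) = sto c @ sto d"
| "sto (Cond e c d) = sto c @ sto d"
| "sto (For x r c) = sto c"
| "sto Skip = []"

text \<open>For a fixed program these registers determine the time bound: each loop takes its number
  of rounds from one of them.\<close>

fun lreg :: "com \<Rightarrow> nat list" where
  "lreg (Asg x e) = []"
| "lreg (St a i e) = []"
| "lreg (Sq c d) = lreg c @ lreg d"
| "lreg (Cond e c d) = lreg c @ lreg d"
| "lreg (For x r c) = r # lreg c"
| "lreg Skip = []"

fun wfe :: "exp \<Rightarrow> bool" where
  "wfe (Cn k) = True"
| "wfe (V x) = (x < 30)"
| "wfe (Pl a b) = (wfe a \<and> wfe b)"
| "wfe (Mi a b) = (wfe a \<and> wfe b)"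
| "wfe (Ld a e) = (a < 8 \<and> wfe e)"
| "wfe (In e) = wfe e"

abbreviation disj :: "nat list \<Rightarrow> nat list \<Rightarrow> bool" where
  "disj xs ys \<equiv> list_all (\<lambda>x. x \<notin> set ys) xs"

text \<open>Besides ranges of registers and arrays, this ensures that every loop bound still has its
  initial value when its loop is reached. The number of rounds is then known in the starting state,
  which lets \<open>cost\<close> be a function of that state. Register 3 keeps the array base and is
  therefore never assigned.\<close>

fun ok :: "com \<Rightarrow> bool" where
  "ok (Asg x e) = (x < 30 \<and> x \<noteq> 3 \<and> wfe e)"
| "ok (St a i e) = (a < 8 \<and> wfe i \<and> wfe e)"
| "ok (Sq c d) = (ok c \<and> ok d \<and> disj (lreg d) (asg c))"
| "ok (Cond e c d) = (wfe e \<and> ok c \<and> ok d)"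
| "ok (For x r c) = (x < 30 \<and> x \<noteq> 3 \<and> r < 30 \<and> x \<notin> set (asg c) \<and> ok c \<and>
     disj (r # lreg c) (x # asg c))"
| "ok Skip = True"

section \<open>Running times as polynomials in the loop bounds\<close>

fun ecost :: "exp \<Rightarrow> nat" where
  "ecost (Cn k) = 1"
| "ecost (V x) = 2"
| "ecost (Pl a b) = ecost a + ecost b + 1"
| "ecost (Mi a b) = ecost a + ecost b + 1"
| "ecost (Ld a e) = ecost e + 7"
| "ecost (In e) = ecost e + 3"

text \<open>An upper bound: a conditional is charged for both branches. In a loop, 3 pays for the
  two initial instructions and the failing test, and 4 for a successful test and the three
  instructions after the body.\<close>

fun cost :: "(nat \<Rightarrow> nat) \<Rightarrow> com \<Rightarrow> nat" where
  "cost \<beta> (Asg x e) = ecost e + 2"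
| "cost \<beta> (St a i e) = ecost i + ecost e + 7"
| "cost \<beta> (Sq c d) = cost \<beta> c + cost \<beta> d"
| "cost \<beta> (Cond e c d) = ecost e + 1 + cost \<beta> c + cost \<beta> d"
| "cost \<beta> (For x r c) = 3 + \<beta> r * (cost \<beta> c + 4)"
| "cost \<beta> Skip = 1"

lemma cost_cong: "(\<And>r. r \<in> set (lreg c) \<Longrightarrow> \<beta> r = \<gamma> r) \<Longrightarrow> cost \<beta> c = cost \<gamma> c"
  by (induction c) auto

text \<open>Sequencing adds the degrees, which is crude but enough, and a loop raises the degree by
  one. \<open>K\<close> and \<open>D\<close> depend only on the program text; this uniformity later
  yields one exponent for all graphs and all c.\<close>

lemma cost_polynomial: "\<exists>K D. \<forall>\<beta> X. X \<ge> 1 \<and> (\<forall>r \<in> set (lreg c). \<beta> r \<le> X) \<longrightarrow> cost \<beta> c \<le> K * X ^ D"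
proof (induction c)
  case (Asg x e)
  show ?case by (intro exI[of _ "ecost e + 2"] exI[of _ 0]) simp
next
  case (St a i e)
  show ?case by (intro exI[of _ "ecost i + ecost e + 7"] exI[of _ 0]) simp
next
  case (Sq c d)
  obtain K D where 1: "\<And>\<beta> X. X \<ge> 1 \<Longrightarrow> \<forall>r \<in> set (lreg c). \<beta> r \<le> X \<Longrightarrow> cost \<beta> c \<le> K * X ^ D"
    using Sq.IH(1) by blast
  obtain L E where 2: "\<And>\<beta> X. X \<ge> 1 \<Longrightarrow> \<forall>r \<in> set (lreg d). \<beta> r \<le> X \<Longrightarrow> cost \<beta> d \<le> L * X ^ E"
    using Sq.IH(2) by blast
  have "cost \<beta> (Sq c d) \<le> (K + L) * X ^ (D + E)"
    if "X \<ge> 1" "\<forall>r \<in> set (lreg (Sq c d)). \<beta> r \<le> X" for \<beta> X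
  proof -
    have "cost \<beta> c \<le> K * X ^ D" "cost \<beta> d \<le> L * X ^ E" using 1 2 that by auto
    moreover have "K * X ^ D \<le> K * X ^ (D + E)" "L * X ^ E \<le> L * X ^ (D + E)"
      using that(1) by (auto intro!: power_increasing)
    ultimately show ?thesis unfolding add_mult_distrib cost.simps by linarith
  qed
  then show ?case by blast
next
  case (Cond e c d)
  obtain K D where 1: "\<And>\<beta> X. X \<ge> 1 \<Longrightarrow> \<forall>r \<in> set (lreg c). \<beta> r \<le> X \<Longrightarrow> cost \<beta> c \<le> K * X ^ D"
    using Cond.IH(1) by blast
  obtain L E where 2: "\<And>\<beta> X. X \<ge> 1 \<Longrightarrow> \<forall>r \<in> set (lreg d). \<beta> r \<le> X \<Longrightarrow> cost \<beta> d \<le> L * X ^ E"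
    using Cond.IH(2) by blast
  have "cost \<beta> (Cond e c d) \<le> (ecost e + 1 + K + L) * X ^ (D + E)"
    if "X \<ge> 1" "\<forall>r \<in> set (lreg (Cond e c d)). \<beta> r \<le> X" for \<beta> X
  proof -
    have "cost \<beta> c \<le> K * X ^ D" "cost \<beta> d \<le> L * X ^ E" using 1 2 that by auto
    moreover have "K * X ^ D \<le> K * X ^ (D + E)" "L * X ^ E \<le> L * X ^ (D + E)"
      using that(1) by (auto intro!: power_increasing)
    moreover have "(ecost e + 1) * 1 \<le> (ecost e + 1) * X ^ (D + E)"
      by (rule mult_le_mono2) (use that(1) in simp)
    ultimately show ?thesis unfolding add_mult_distrib cost.simps by linarith
  qed
  then show ?case by blast
next
  case (For x r c)
  obtain K D where 1: "\<And>\<beta> X. X \<ge> 1 \<Longrightarrow> \<forall>r \<in> set (lreg c). \<beta> r \<le> X \<Longrightarrow> cost \<beta> c \<le> K * X ^ D"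
    using For.IH by blast
  have "cost \<beta> (For x r c) \<le> (K + 7) * X ^ (Suc D)"
    if "X \<ge> 1" "\<forall>q \<in> set (lreg (For x r c)). \<beta> q \<le> X" for \<beta> X
  proof -
    have c: "cost \<beta> c \<le> K * X ^ D" using 1 that by auto
    have X1: "1 \<le> X ^ D" "1 \<le> X ^ Suc D" using that(1) by (simp_all del: power_Suc)
    have "\<beta> r * (cost \<beta> c + 4) \<le> X * (K * X ^ D + 4 * X ^ D)"
      by (rule mult_le_mono) (use that c X1(1) in \<open>auto intro!: add_mono simp del: One_nat_def\<close>)
    moreover have "X * (K * X ^ D + 4 * X ^ D) + 3 * X ^ Suc D = (K + 7) * X ^ Suc D"
      by (simp add: algebra_simps)
    ultimately show ?thesis using X1(2) unfolding cost.simps by linarith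
  qed
  then show ?case by blast
next
  case Skip
  show ?case by (intro exI[of _ 1] exI[of _ 0]) simp
qed

section \<open>Compilation and its correctness\<close>

fun cexp :: "exp \<Rightarrow> nat \<Rightarrow> prog" where
  "cexp (Cn k) t = Instr (Const t k)"
| "cexp (V x) t = Seq (Instr (Const t 0)) (Instr (Add t x t))"
| "cexp (Pl a b) t = Seq (cexp a t) (Seq (cexp b (Suc t)) (Instr (Add t t (Suc t))))"
| "cexp (Mi a b) t = Seq (cexp a t) (Seq (cexp b (Suc t)) (Instr (Sub t t (Suc t))))"
| "cexp (Ld a e) t = Seq (cexp e t) (Seq (Instr (Add t t t)) (Seq (Instr (Add t t t))
     (Seq (Instr (Add t t t)) (Seq (Instr (Const (Suc t) a)) (Seq (Instr (Add t t (Suc t)))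
     (Seq (Instr (Add t t 3)) (Instr (Load t t))))))))"
| "cexp (In e) t = Seq (cexp e t) (Seq (Instr (Sub (Suc t) 3 t))
     (IfNZ (Suc t) (Instr (Load t t)) (Instr (Const t 0))))"

fun compile :: "com \<Rightarrow> prog" where
  "compile (Asg x e) = Seq (cexp e 30) (Seq (Instr (Const 31 0)) (Instr (Add x 30 31)))"
| "compile (St a i e) = Seq (cexp e 30) (Seq (cexp i 31) (Seq (Instr (Add 31 31 31))
     (Seq (Instr (Add 31 31 31)) (Seq (Instr (Add 31 31 31)) (Seq (Instr (Const 32 a))
     (Seq (Instr (Add 31 31 32)) (Seq (Instr (Add 31 31 3)) (Instr (Store 31 30)))))))))"
| "compile (Sq c d) = Seq (compile c) (compile d)"
| "compile (Cond e c d) = Seq (cexp e 30) (IfNZ 30 (compile c) (compile d))"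
| "compile (For x r c) = Seq (Instr (Const x 0)) (Seq (Instr (Sub 30 r x))
     (WhileNZ 30 (Seq (compile c) (Seq (Instr (Const 31 1)) (Seq (Instr (Add x x 31))
       (Instr (Sub 30 r x)))))))"
| "compile Skip = Instr (Const 30 0)"

text \<open>The input is extended by 0 beyond the array base, in accordance with the guarded load in
  \<open>cexp\<close>, so that reads out of range are defined. Registers from 30 on are left free
  because compiled code may overwrite them at any time.\<close>

definition refines :: "st \<Rightarrow> ram_state \<Rightarrow> bool" where
  "refines s \<sigma> \<longleftrightarrow> (\<forall>x<30. regs \<sigma> x = vr s x) \<and>
     (\<forall>a<8. \<forall>i. mem \<sigma> (vr s 3 + (8 * i + a)) = ar s a i) \<and>
     (\<forall>i. inp s i = (if i < vr s 3 then mem \<sigma> i else 0))"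

definition runs :: "prog \<Rightarrow> st \<Rightarrow> nat \<Rightarrow> st \<Rightarrow> bool" where
  "runs P s T s' \<longleftrightarrow>
     (\<forall>\<sigma>. refines s \<sigma> \<longrightarrow> (\<exists>t \<sigma>'. exec P \<sigma> t \<sigma>' \<and> t \<le> T \<and> refines s' \<sigma>'))"

lemma runs_Seq: "runs P s T s' \<Longrightarrow> runs Q s' U s'' \<Longrightarrow> runs (Seq P Q) s (T + U) s''"
  unfolding runs_def by (meson exec.Seq add_mono)

text \<open>Temporaries form a stack growing upwards from \<open>t\<close>: evaluating the right
  operand at \<open>Suc t\<close> preserves the value of the left one in \<open>t\<close>, by the
  clause on registers below the target. The factor 8 in an address is obtained by three
  doublings.\<close>

lemma exec_cexp:
  assumes "wfe e" "t \<ge> 30" "refines s \<sigma>"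
  shows "\<exists>\<sigma>'. exec (cexp e t) \<sigma> (ecost e) \<sigma>' \<and> regs \<sigma>' t = eval e s \<and>
    (\<forall>i<t. regs \<sigma>' i = regs \<sigma> i) \<and> mem \<sigma>' = mem \<sigma>"
  using assms
proof (induction e arbitrary: t \<sigma>)
  case (Cn k)
  show ?case using exec.Instr[of "Const t k" \<sigma>] by (intro exI[of _ "step (Const t k) \<sigma>"]) simp
next
  case (V x)
  have "exec (cexp (V x) t) \<sigma> (1 + 1) (step (Add t x t) (step (Const t 0) \<sigma>))"
    unfolding cexp.simps by (rule exec.Seq[OF exec.Instr exec.Instr])
  then show ?case using V by (intro exI) (auto simp: refines_def numeral_2_eq_2)
next
  case (Pl a b)
  obtain \<sigma>1 where 1: "exec (cexp a t) \<sigma> (ecost a) \<sigma>1" "regs \<sigma>1 t = eval a s"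
    "\<forall>i<t. regs \<sigma>1 i = regs \<sigma> i" "mem \<sigma>1 = mem \<sigma>" using Pl by force
  have "refines s \<sigma>1" using Pl.prems 1 by (simp add: refines_def)
  then obtain \<sigma>2 where 2: "exec (cexp b (Suc t)) \<sigma>1 (ecost b) \<sigma>2" "regs \<sigma>2 (Suc t) = eval b s"
    "\<forall>i<Suc t. regs \<sigma>2 i = regs \<sigma>1 i" "mem \<sigma>2 = mem \<sigma>1" using Pl.IH(2)[of "Suc t" \<sigma>1] Pl.prems by force
  have "exec (cexp (Pl a b) t) \<sigma> (ecost a + (ecost b + 1)) (step (Add t t (Suc t)) \<sigma>2)"
    unfolding cexp.simps by (rule 1(1) 2(1) exec.Seq exec.Instr)+
  then show ?case using 1 2 by (intro exI) (auto simp: add.assoc)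
next
  case (Mi a b)
  obtain \<sigma>1 where 1: "exec (cexp a t) \<sigma> (ecost a) \<sigma>1" "regs \<sigma>1 t = eval a s"
    "\<forall>i<t. regs \<sigma>1 i = regs \<sigma> i" "mem \<sigma>1 = mem \<sigma>" using Mi by force
  have "refines s \<sigma>1" using Mi.prems 1 by (simp add: refines_def)
  then obtain \<sigma>2 where 2: "exec (cexp b (Suc t)) \<sigma>1 (ecost b) \<sigma>2" "regs \<sigma>2 (Suc t) = eval b s"
    "\<forall>i<Suc t. regs \<sigma>2 i = regs \<sigma>1 i" "mem \<sigma>2 = mem \<sigma>1" using Mi.IH(2)[of "Suc t" \<sigma>1] Mi.prems by force
  have "exec (cexp (Mi a b) t) \<sigma> (ecost a + (ecost b + 1)) (step (Sub t t (Suc t)) \<sigma>2)"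
    unfolding cexp.simps by (rule 1(1) 2(1) exec.Seq exec.Instr)+
  then show ?case using 1 2 by (intro exI) (auto simp: add.assoc)
next
  case (Ld a e)
  obtain \<sigma>1 where 1: "exec (cexp e t) \<sigma> (ecost e) \<sigma>1" "regs \<sigma>1 t = eval e s"
    "\<forall>i<t. regs \<sigma>1 i = regs \<sigma> i" "mem \<sigma>1 = mem \<sigma>" using Ld by force
  let ?\<sigma> = "step (Load t t) (step (Add t t 3) (step (Add t t (Suc t)) (step (Const (Suc t) a)
    (step (Add t t t) (step (Add t t t) (step (Add t t t) \<sigma>1))))))"
  have "exec (cexp (Ld a e) t) \<sigma> (ecost e + (1 + (1 + (1 + (1 + (1 + (1 + 1))))))) ?\<sigma>"
    unfolding cexp.simps by (rule 1(1) exec.Seq exec.Instr)+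
  moreover have "regs ?\<sigma> t = mem \<sigma>1 (eval e s + eval e s + (eval e s + eval e s) +
    (eval e s + eval e s + (eval e s + eval e s)) + a + regs \<sigma>1 3)"
    using 1 Ld.prems by simp
  moreover have "\<dots> = eval (Ld a e) s"
  proof -
    have "mem \<sigma> (vr s 3 + (8 * eval e s + a)) = ar s a (eval e s)"
      using Ld.prems unfolding refines_def by auto
    moreover have "regs \<sigma>1 3 = vr s 3" using 1 Ld.prems by (simp add: refines_def)
    moreover have "k + k + (k + k) + (k + k + (k + k)) + a + B = B + (8 * k + a)" for k B :: nat
      by simp
    ultimately show ?thesis using 1 by (simp only: eval.simps)
  qed
  moreover have "ecost e + (1 + (1 + (1 + (1 + (1 + (1 + 1)))))) = ecost (Ld a e)" by simp
  moreover have "(\<forall>i<t. regs ?\<sigma> i = regs \<sigma> i) \<and> mem ?\<sigma> = mem \<sigma>" using 1 by simp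
  ultimately show ?case by metis
next
  case (In e)
  obtain \<sigma>1 where 1: "exec (cexp e t) \<sigma> (ecost e) \<sigma>1" "regs \<sigma>1 t = eval e s"
    "\<forall>i<t. regs \<sigma>1 i = regs \<sigma> i" "mem \<sigma>1 = mem \<sigma>" using In by force
  have 3: "regs \<sigma>1 3 = vr s 3" using 1 In.prems by (simp add: refines_def)
  let ?\<sigma>2 = "step (Sub (Suc t) 3 t) \<sigma>1"
  show ?case
  proof (cases "eval e s < vr s 3")
    case True
    have "exec (cexp (In e) t) \<sigma> (ecost e + (1 + (1 + 1))) (step (Load t t) ?\<sigma>2)"
      by (simp only: cexp.simps) (rule exec.Seq[OF 1(1) exec.Seq[OF exec.Instr exec.IfTrue[OF _ exec.Instr]]], use 1 3 True in simp)
    then show ?thesis using 1 3 True In.prems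
      by (intro exI) (auto simp: refines_def numeral_3_eq_3)
  next
    case False
    have "exec (cexp (In e) t) \<sigma> (ecost e + (1 + (1 + 1))) (step (Const t 0) ?\<sigma>2)"
      by (simp only: cexp.simps) (rule exec.Seq[OF 1(1) exec.Seq[OF exec.Instr exec.IfFalse[OF _ exec.Instr]]], use 1 3 False in simp)
    then show ?thesis using 1 3 False In.prems
      by (intro exI) (auto simp: refines_def numeral_3_eq_3)
  qed
qed

lemma exec_cexp_refines:
  assumes "wfe e" "t \<ge> 30" "refines s \<sigma>"
  obtains \<sigma>' where "exec (cexp e t) \<sigma> (ecost e) \<sigma>'" "regs \<sigma>' t = eval e s"
    "\<And>i. i < t \<Longrightarrow> regs \<sigma>' i = regs \<sigma> i" "mem \<sigma>' = mem \<sigma>" "refines s \<sigma>'"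
proof -
  obtain \<sigma>' where s: "exec (cexp e t) \<sigma> (ecost e) \<sigma>'" "regs \<sigma>' t = eval e s"
    "\<forall>i<t. regs \<sigma>' i = regs \<sigma> i" "mem \<sigma>' = mem \<sigma>" using exec_cexp[OF assms] by blast
  have "refines s \<sigma>'" using s assms by (simp add: refines_def)
  then show ?thesis using s that by blast
qed

section \<open>Frame properties and the invariant rule\<close>

lemma iter_unchanged:
  assumes "\<And>s. P (f s) = P s" "\<And>s k. P (set_var x k s) = P s"
  shows "P (iter x f j s) = P s"
  by (induction j) (use assms in simp_all)

lemma vr_exe: "y \<notin> set (asg c) \<Longrightarrow> vr (exe c s) y = vr s y"
proof (induction c arbitrary: s)
  case (For x r c)
  then show ?case by (auto intro!: iter_unchanged[where P = "\<lambda>s. vr s y"])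
qed auto

lemma ar_exe: "a \<notin> set (sto c) \<Longrightarrow> ar (exe c s) a = ar s a"
proof (induction c arbitrary: s)
  case (For x r c)
  then show ?case by (auto intro!: iter_unchanged[where P = "\<lambda>s. ar s a"])
qed auto

lemma inp_exe: "inp (exe c s) = inp s"
proof (induction c arbitrary: s)
  case (For x r c)
  then show ?case by (auto intro!: iter_unchanged[where P = "inp"])
qed auto

lemma vr_iter_counter: "vr (iter x f j s) x = j"
  by (cases j) auto

theorem runs_comp:
  assumes "ok c"
  shows "runs (compile c) s (cost (vr s) c) (exe c s)"
  using assms
proof (induction c arbitrary: s)
  case (Asg x e)
  show ?case unfolding runs_def
  proof (intro allI impI)
    fix \<sigma> assume R: "refines s \<sigma>"
    obtain \<sigma>1 where 1: "exec (cexp e 30) \<sigma> (ecost e) \<sigma>1" "regs \<sigma>1 30 = eval e s"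
      "refines s \<sigma>1" using exec_cexp_refines[OF _ _ R, of e 30] Asg by auto
    have "exec (compile (Asg x e)) \<sigma> (ecost e + (1 + 1)) (step (Add x 30 31) (step (Const 31 0) \<sigma>1))"
      unfolding compile.simps by (rule exec.Seq[OF 1(1) exec.Seq[OF exec.Instr exec.Instr]])
    moreover have "refines (exe (Asg x e) s) (step (Add x 30 31) (step (Const 31 0) \<sigma>1))"
      using 1 Asg by (auto simp: refines_def)
    ultimately show "\<exists>t \<sigma>'. exec (compile (Asg x e)) \<sigma> t \<sigma>' \<and> t \<le> cost (vr s) (Asg x e) \<and>
        refines (exe (Asg x e) s) \<sigma>'" by fastforce
  qed
next
  case (St a i e)
  show ?case unfolding runs_def
  proof (intro allI impI)
    fix \<sigma> assume R: "refines s \<sigma>"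
    obtain \<sigma>1 where 1: "exec (cexp e 30) \<sigma> (ecost e) \<sigma>1" "regs \<sigma>1 30 = eval e s"
      "refines s \<sigma>1" using exec_cexp_refines[OF _ _ R, of e 30] St by auto
    obtain \<sigma>2 where 2: "exec (cexp i 31) \<sigma>1 (ecost i) \<sigma>2" "regs \<sigma>2 31 = eval i s"
      "regs \<sigma>2 30 = regs \<sigma>1 30" "refines s \<sigma>2"
      by (rule exec_cexp_refines[OF _ _ 1(3), of i 31]) (use St in force)+
    let ?\<sigma> = "step (Store 31 30) (step (Add 31 31 3) (step (Add 31 31 32) (step (Const 32 a)
      (step (Add 31 31 31) (step (Add 31 31 31) (step (Add 31 31 31) \<sigma>2))))))"
    have "exec (compile (St a i e)) \<sigma> (ecost e + (ecost i + (1 + (1 + (1 + (1 + (1 + (1 + 1)))))))) ?\<sigma>"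
      unfolding compile.simps by (rule 1(1) 2(1) exec.Seq exec.Instr)+
    moreover have "refines (exe (St a i e) s) ?\<sigma>"
    proof -
      have m: "mem ?\<sigma> = (mem \<sigma>2)(vr s 3 + (8 * eval i s + a) := eval e s)"
      proof -
        have "mem ?\<sigma> = (mem \<sigma>2)(eval i s + eval i s + (eval i s + eval i s) +
          (eval i s + eval i s + (eval i s + eval i s)) + a + vr s 3 := eval e s)"
          using 1 2 by (simp add: refines_def)
        moreover have "k + k + (k + k) + (k + k + (k + k)) + a + B = B + (8 * k + a)" for k B :: nat
          by simp
        ultimately show ?thesis by (simp only:)
      qed
      have r: "\<forall>x<30. regs ?\<sigma> x = vr s x" using 2 by (simp add: refines_def)
      \<comment> \<open>The residue modulo 8 identifies the array, both names being below 8. A store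
        therefore changes exactly one cell of one array.\<close>
      have "8 * i' + a' = 8 * j + a \<longleftrightarrow> a' = a \<and> i' = j" if "a' < 8" for a' i' j
        using that St.prems by auto presburger+
      then show ?thesis using 2(4) r St.prems
        unfolding refines_def m by auto
    qed
    ultimately show "\<exists>t \<sigma>'. exec (compile (St a i e)) \<sigma> t \<sigma>' \<and> t \<le> cost (vr s) (St a i e) \<and>
        refines (exe (St a i e) s) \<sigma>'" by fastforce
  qed
next
  case (Sq c d)
  \<comment> \<open>The second command may be charged in the initial state because the first one
    assigns none of its loop bounds.\<close>
  have "cost (vr (exe c s)) d = cost (vr s) d"
    by (rule cost_cong) (use Sq.prems in \<open>auto simp: list_all_iff vr_exe\<close>)
  then show ?case using runs_Seq[OF Sq.IH(1)[of s] Sq.IH(2)[of "exe c s"]] Sq.prems by simp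
next
  case (Cond e c d)
  show ?case unfolding runs_def
  proof (intro allI impI)
    fix \<sigma> assume R: "refines s \<sigma>"
    obtain \<sigma>1 where 1: "exec (cexp e 30) \<sigma> (ecost e) \<sigma>1" "regs \<sigma>1 30 = eval e s"
      "refines s \<sigma>1" using exec_cexp_refines[OF _ _ R, of e 30] Cond.prems by auto
    show "\<exists>t \<sigma>'. exec (compile (Cond e c d)) \<sigma> t \<sigma>' \<and> t \<le> cost (vr s) (Cond e c d) \<and>
        refines (exe (Cond e c d) s) \<sigma>'"
    proof (cases "eval e s = 0")
      case True
      obtain t \<sigma>2 where 2: "exec (compile d) \<sigma>1 t \<sigma>2" "t \<le> cost (vr s) d" "refines (exe d s) \<sigma>2"
        using Cond.IH(2)[of s] Cond.prems 1(3) unfolding runs_def by auto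
      have "exec (compile (Cond e c d)) \<sigma> (ecost e + (t + 1)) \<sigma>2"
        by (simp only: compile.simps) (rule exec.Seq[OF 1(1) exec.IfFalse[OF _ 2(1)]], use 1 True in simp)
      then show ?thesis using 2 True by (intro exI[of _ "ecost e + (t + 1)"] exI[of _ \<sigma>2]) auto
    next
      case False
      obtain t \<sigma>2 where 2: "exec (compile c) \<sigma>1 t \<sigma>2" "t \<le> cost (vr s) c" "refines (exe c s) \<sigma>2"
        using Cond.IH(1)[of s] Cond.prems 1(3) unfolding runs_def by auto
      have "exec (compile (Cond e c d)) \<sigma> (ecost e + (t + 1)) \<sigma>2"
        by (simp only: compile.simps) (rule exec.Seq[OF 1(1) exec.IfTrue[OF _ 2(1)]], use 1 False in simp)
      then show ?thesis using 2 False by (intro exI[of _ "ecost e + (t + 1)"] exI[of _ \<sigma>2]) auto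
    qed
  qed
next
  case (For x r c)
  have wf: "x < 30" "x \<noteq> 3" "r < 30" "x \<notin> set (asg c)" "ok c" "r \<noteq> x" "r \<notin> set (asg c)"
    and lr: "\<And>q. q \<in> set (lreg c) \<Longrightarrow> q \<noteq> x \<and> q \<notin> set (asg c)"
    using For.prems by (auto simp: list_all_iff)
  let ?m = "vr s r" and ?it = "\<lambda>j. iter x (exe c) j s" and ?B = "cost (vr s) c"
  let ?body = "Seq (compile c) (Seq (Instr (Const 31 1)) (Seq (Instr (Add x x 31)) (Instr (Sub 30 r x))))"
  have cst: "vr (?it j) y = vr s y" if "y \<noteq> x" "y \<notin> set (asg c)" for j y
    by (rule iter_unchanged[where P = "\<lambda>s. vr s y"]) (use that in \<open>auto simp: vr_exe\<close>)
  have costj: "cost (vr (?it j)) c = ?B" for j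
    by (rule cost_cong) (use lr cst in auto)
  \<comment> \<open>Induction on the number of rounds left, which register 30 holds whenever the
    loop test is reached; the body may destroy it, so it is recomputed after each round.\<close>
  have loop: "\<exists>t \<sigma>'. exec (WhileNZ 30 ?body) \<sigma> t \<sigma>' \<and> t \<le> i * (?B + 4) + 1 \<and> refines (?it ?m) \<sigma>'"
    if "refines (?it j) \<sigma>" "regs \<sigma> 30 = i" "j + i = ?m" for i j \<sigma>
    using that
  proof (induction i arbitrary: j \<sigma>)
    case 0
    then show ?case using exec.WhileFalse[of \<sigma> 30 ?body] by force
  next
    case (Suc i)
    obtain t \<sigma>1 where 1: "exec (compile c) \<sigma> t \<sigma>1" "t \<le> ?B" "refines (exe c (?it j)) \<sigma>1"
      using For.IH[OF wf(5), of "?it j"] Suc.prems(1) costj unfolding runs_def by auto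
    let ?\<sigma>2 = "step (Sub 30 r x) (step (Add x x 31) (step (Const 31 1) \<sigma>1))"
    have b: "exec ?body \<sigma> (t + (1 + (1 + 1))) ?\<sigma>2"
      by (rule 1(1) exec.Seq exec.Instr)+
    have vx: "vr (exe c (?it j)) x = j" using wf by (simp add: vr_exe vr_iter_counter)
    have vr: "vr (exe c (?it j)) r = ?m" using wf by (simp add: vr_exe cst)
    have R2: "refines (?it (Suc j)) ?\<sigma>2"
      using 1(3) wf vx by (auto simp: refines_def)
    have "regs \<sigma>1 x = j" "regs \<sigma>1 r = ?m" using 1(3) wf vx vr by (auto simp: refines_def)
    then have "regs ?\<sigma>2 30 = i" using Suc.prems(3) wf by simp
    then obtain u \<sigma>3 where 3: "exec (WhileNZ 30 ?body) ?\<sigma>2 u \<sigma>3" "u \<le> i * (?B + 4) + 1"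
      "refines (?it ?m) \<sigma>3" using Suc.IH[OF R2] Suc.prems(3) by auto
    have "exec (WhileNZ 30 ?body) \<sigma> (t + (1 + (1 + 1)) + u + 1) \<sigma>3"
      by (rule exec.WhileTrue[OF _ b 3(1)]) (use Suc.prems in simp)
    moreover have "t + (1 + (1 + 1)) + u + 1 \<le> Suc i * (?B + 4) + 1"
      using 1 3 by simp
    ultimately show ?case using 3(3) by blast
  qed
  show ?case unfolding runs_def
  proof (intro allI impI)
    fix \<sigma> assume R: "refines s \<sigma>"
    let ?\<sigma>1 = "step (Sub 30 r x) (step (Const x 0) \<sigma>)"
    have "refines (?it 0) ?\<sigma>1" "regs ?\<sigma>1 30 = ?m" using R wf by (auto simp: refines_def)
    then obtain t \<sigma>' where "exec (WhileNZ 30 ?body) ?\<sigma>1 t \<sigma>'" "t \<le> ?m * (?B + 4) + 1"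
      "refines (?it ?m) \<sigma>'" using loop[of 0 ?\<sigma>1 ?m] by auto
    moreover from this have "exec (compile (For x r c)) \<sigma> (1 + (1 + t)) \<sigma>'"
      unfolding compile.simps by (intro exec.Seq[OF exec.Instr exec.Seq[OF exec.Instr]])
    ultimately show "\<exists>t \<sigma>'. exec (compile (For x r c)) \<sigma> t \<sigma>' \<and> t \<le> cost (vr s) (For x r c) \<and>
        refines (exe (For x r c) s) \<sigma>'"
      by (intro exI[of _ "1 + (1 + t)"] exI[of _ \<sigma>']) auto
  qed
next
  case Skip
  have "exec (compile Skip) \<sigma> 1 (step (Const 30 0) \<sigma>)" for \<sigma>
    unfolding compile.simps by (rule exec.Instr)
  moreover have "refines s (step (Const 30 0) \<sigma>)" if "refines s \<sigma>" for \<sigma>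
    using that by (simp add: refines_def)
  ultimately show ?case unfolding runs_def by (metis cost.simps(6) exe.simps(6) order_refl)
qed

text \<open>The invariant rule brings its own frame: whatever the body does not syntactically assign
  still has its value from before the loop. Invariants can therefore be confined to what a loop
  changes.\<close>

lemma For_rule:
  assumes "I 0 (set_var x 0 s)"
    and "\<And>j t. j < vr s r \<Longrightarrow> vr t x = j \<Longrightarrow> I j t \<Longrightarrow>
      (\<And>y. y \<noteq> x \<Longrightarrow> y \<notin> set (asg c) \<Longrightarrow> vr t y = vr s y) \<Longrightarrow>
      (\<And>a. a \<notin> set (sto c) \<Longrightarrow> ar t a = ar s a) \<Longrightarrow> inp t = inp s \<Longrightarrow>
      I (Suc j) (set_var x (Suc j) (exe c t))"
  shows "I (vr s r) (exe (For x r c) s)"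
proof -
  have "I j (iter x (exe c) j s)" if "j \<le> vr s r" for j
    using that
  proof (induction j)
    case 0
    then show ?case using assms(1) by simp
  next
    case (Suc j)
    have "vr (iter x (exe c) j s) y = vr s y" if "y \<noteq> x" "y \<notin> set (asg c)" for y
      by (rule iter_unchanged[where P = "\<lambda>s. vr s y"]) (use that in \<open>auto simp: vr_exe\<close>)
    moreover have "ar (iter x (exe c) j s) a = ar s a" if "a \<notin> set (sto c)" for a
      by (rule iter_unchanged[where P = "\<lambda>s. ar s a"]) (use that in \<open>auto simp: ar_exe\<close>)
    moreover have "inp (iter x (exe c) j s) = inp s"
      by (rule iter_unchanged[where P = inp]) (auto simp: inp_exe)
    ultimately show ?case using assms(2)[of j "iter x (exe c) j s"] Suc vr_iter_counter by simp
  qed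
  then show ?thesis by simp
qed

section \<open>Bounded improving moves\<close>

lemma sum_mset_nonneg_int:
  fixes f :: "'b \<Rightarrow> int"
  shows "(\<And>v. v \<in># A \<Longrightarrow> 0 \<le> f v) \<Longrightarrow> 0 \<le> (\<Sum>v\<in>#A. f v)"
  by (induction A) auto

lemma sum_mset_negf_int:
  fixes f :: "'b \<Rightarrow> int"
  shows "(\<Sum>v\<in>#A. - f v) = - (\<Sum>v\<in>#A. f v)"
  by (induction A) auto

text \<open>Choose the elements greedily so that the partial sums stay in \<open>{1 - B..B}\<close>. Either some
  initial segment has its sum between 0 and the total, or two of the first \<open>2 * B + 1\<close>
  partial sums coincide.\<close>

lemma small_block:
  fixes L :: "'b \<Rightarrow> int"
  assumes ne: "D \<noteq> {#}" and bd: "\<And>v. v \<in># D \<Longrightarrow> \<bar>L v\<bar> \<le> int B" and B: "B \<ge> 1"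
    and T: "(\<Sum>v\<in>#D. L v) \<ge> 0"
  shows "\<exists>E. E \<subseteq># D \<and> E \<noteq> {#} \<and> size E \<le> 2 * B \<and> 0 \<le> (\<Sum>v\<in>#E. L v) \<and> (\<Sum>v\<in>#E. L v) \<le> (\<Sum>v\<in>#D. L v)"
proof (rule ccontr)
  assume no: "\<not> ?thesis"
  let ?T = "\<Sum>v\<in>#D. L v" and ?S = "\<lambda>xs. sum_list (map L xs)"
  have neg: "\<exists>x\<in>#A. L x < 0" if "(\<Sum>v\<in>#A. L v) < 0" for A
  proof (rule ccontr)
    assume "\<not> ?thesis"
    then have "\<forall>v\<in>#A. 0 \<le> L v" by (auto simp: not_less)
    then have "0 \<le> (\<Sum>v\<in>#A. L v)" by (induction A) auto
    then show False using that by simp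
  qed
  have nonneg: "\<exists>x\<in>#A. 0 \<le> L x" if "0 \<le> (\<Sum>v\<in>#A. L v)" "A \<noteq> {#}" for A
  proof (rule ccontr)
    assume "\<not> ?thesis"
    then have "\<forall>v\<in>#A. L v \<le> -1" by auto
    then have "(\<Sum>v\<in>#A. L v) \<le> - int (size A)" by (induction A) auto
    then show False using that by (simp add: nonempty_has_size)
  qed
  have S: "?S xs = (\<Sum>v\<in>#mset xs. L v)" for xs
    by (simp flip: sum_mset_sum_list)
  have "\<exists>xs. length xs = m \<and> mset xs \<subseteq># D \<and> (\<forall>i\<le>m. ?S (take i xs) \<in> {1 - int B..int B})"
    if "m \<le> 2 * B" for m
    using that
  proof (induction m)
    case 0
    then show ?case using B by (intro exI[of _ "[]"]) auto
  next
    case (Suc m)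
    then obtain xs where xs: "length xs = m" "mset xs \<subseteq># D" "\<And>i. i \<le> m \<Longrightarrow> ?S (take i xs) \<in> {1 - int B..int B}"
      by auto
    let ?s = "?S xs"
    have s: "?s \<in> {1 - int B..int B}" using xs(3)[of m] xs(1) by simp
    have rest: "(\<Sum>v\<in>#D - mset xs. L v) = ?T - ?s"
    proof -
      have "D = mset xs + (D - mset xs)" using xs(2) by simp
      then have "?T = (\<Sum>v\<in>#mset xs + (D - mset xs). L v)" by simp
      then show ?thesis unfolding S by simp
    qed
    \<comment> \<open>A nonempty prefix whose sum lies between 0 and the total would itself be one
      of the excluded blocks, as it has at most 2B elements.\<close>
    have c: "m = 0 \<or> ?s < 0 \<or> ?s > ?T"
    proof (rule ccontr)
      assume "\<not> ?thesis"
      then have "mset xs \<noteq> {#}" "0 \<le> ?s" "?s \<le> ?T" using xs(1) by auto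
      then show False using no xs(1,2) Suc.prems S by (metis Suc_leD size_mset)
    qed
    \<comment> \<open>If the prefix sum exceeds the total, the rest has a negative sum and so
      contains a negative element. Otherwise the prefix sum is at most 0, and the rest is nonempty
      with nonnegative sum, so it contains a nonnegative element. Steps of size at most B in these
      directions stay in the window.\<close>
    obtain x where x: "x \<in># D - mset xs" "?s + L x \<in> {1 - int B..int B}"
    proof (cases "?s > ?T")
      case True
      then obtain x where x: "x \<in># D - mset xs" "L x < 0" using neg[of "D - mset xs"] rest by auto
      then have "\<bar>L x\<bar> \<le> int B" using bd by (meson in_diffD)
      then show ?thesis using x s True T by (intro that[of x]) auto
    next
      case False
      then have s0: "?s \<le> 0" using c xs(1) by auto
      have "D - mset xs \<noteq> {#}" using rest False c ne xs(1) T by auto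
      then obtain x where x: "x \<in># D - mset xs" "0 \<le> L x"
        using nonneg[of "D - mset xs"] rest False by auto
      then have "\<bar>L x\<bar> \<le> int B" using bd by (meson in_diffD)
      then show ?thesis using x s s0 by (intro that[of x]) auto
    qed
    have "mset (xs @ [x]) \<subseteq># D"
    proof -
      have "mset xs + {#x#} \<subseteq># mset xs + (D - mset xs)"
        using x(1) by (intro subset_mset.add_left_mono) simp
      then show ?thesis using xs(2) by simp
    qed
    moreover have "?S (take i (xs @ [x])) \<in> {1 - int B..int B}" if "i \<le> Suc m" for i
      using that xs(1,3) x(2) by (cases "i = Suc m") auto
    ultimately show ?case using xs(1) by (intro exI[of _ "xs @ [x]"]) auto
  qed
  then obtain xs where xs: "length xs = 2 * B" "mset xs \<subseteq># D"
    "\<And>i. i \<le> 2 * B \<Longrightarrow> ?S (take i xs) \<in> {1 - int B..int B}" by blast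
  have "\<not> inj_on (\<lambda>i. ?S (take i xs)) {..2 * B}"
  proof
    assume "inj_on (\<lambda>i. ?S (take i xs)) {..2 * B}"
    then have "card {..2 * B} \<le> card {1 - int B..int B}"
      by (rule card_inj_on_le) (use xs(3) in auto)
    then show False by simp
  qed
  then obtain i j where ij: "i < j" "j \<le> 2 * B" "?S (take i xs) = ?S (take j xs)"
    unfolding inj_on_def by (metis atMost_iff linorder_neqE_nat)
  \<comment> \<open>The segment between two equal prefix sums has sum 0, which lies between 0 and
    the total because the total is nonnegative.\<close>
  let ?ys = "drop i (take j xs)"
  have "take j xs = take i xs @ ?ys"
    using ij(1) by (metis append_take_drop_id min.absorb1 less_imp_le take_take)
  then have "?S (take j xs) = ?S (take i xs) + ?S ?ys" by (metis map_append sum_list_append)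
  then have "(\<Sum>v\<in>#mset ?ys. L v) = 0" using ij(3) S[of ?ys] by linarith
  moreover have "mset ?ys \<subseteq># D"
  proof -
    have "mset ?ys \<subseteq># mset (take j xs)" "mset (take j xs) \<subseteq># mset xs"
      by (metis append_take_drop_id mset_append mset_subset_eq_add_left mset_subset_eq_add_right)+
    then show ?thesis using xs(2) by (meson subset_mset.order_trans)
  qed
  moreover have "size (mset ?ys) = j - i" using ij xs(1) by simp
  moreover have "mset ?ys \<noteq> {#}" using ij xs(1) by auto
  ultimately have "mset ?ys \<subseteq># D \<and> mset ?ys \<noteq> {#} \<and> size (mset ?ys) \<le> 2 * B \<and>
      0 \<le> (\<Sum>v\<in>#mset ?ys. L v) \<and> (\<Sum>v\<in>#mset ?ys. L v) \<le> ?T"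
    using ij T by simp
  then show False using no by blast
qed

section \<open>Decompositions that agree in sign on all subset sums\<close>

definition vsum :: "('a \<Rightarrow> int) multiset \<Rightarrow> 'a \<Rightarrow> int" where
  "vsum D = (\<lambda>r. \<Sum>v\<in>#D. v r)"

lemma vsum_union: "vsum (D + E) = (\<lambda>r. vsum D r + vsum E r)"
  by (auto simp: vsum_def)

lemma sum_vsum: "(\<Sum>r\<in>M. vsum E r) = (\<Sum>v\<in>#E. \<Sum>r\<in>M. v r)"
  unfolding vsum_def by (induction E) (auto simp: sum.distrib)

text \<open>Small blocks are split off one after the other. A block never takes more than the
  current total, so the remaining total stays nonnegative and the argument repeats; this is why
  \<open>small_block\<close> bounds the block sum from above as well.\<close>

lemma regroup_nonneg:
  fixes L :: "('a \<Rightarrow> int) \<Rightarrow> int"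
  assumes "\<And>v. v \<in># D \<Longrightarrow> \<bar>L v\<bar> \<le> int B" "B \<ge> 1" "L (vsum D) \<ge> 0"
    and L: "\<And>E. L (vsum E) = (\<Sum>v\<in>#E. L v)"
  shows "\<exists>D'. vsum D' = vsum D \<and>
    (\<forall>v\<in>#D'. 0 \<le> L v \<and> (\<exists>E. E \<subseteq># D \<and> size E \<le> 2 * B \<and> v = vsum E))"
  using assms(1,3)
proof (induction "size D" arbitrary: D rule: less_induct)
  case less
  show ?case
  proof (cases "D = {#}")
    case True
    then show ?thesis by (intro exI[of _ "{#}"]) auto
  next
    case False
    obtain E where E: "E \<subseteq># D" "E \<noteq> {#}" "size E \<le> 2 * B" "0 \<le> L (vsum E)" "L (vsum E) \<le> L (vsum D)"
      using small_block[of D L B] False less.prems assms(2) unfolding L by blast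
    have D: "D = E + (D - E)" using E(1) by simp
    have "L (vsum D) = L (vsum E) + L (vsum (D - E))"
      using D by (metis L image_mset_union sum_mset.union)
    then have "0 \<le> L (vsum (D - E))" using E(5) by simp
    moreover have "size (D - E) < size D"
      using E(1,2) D by (metis less_add_same_cancel2 nonempty_has_size size_union)
    ultimately obtain D' where D': "vsum D' = vsum (D - E)"
      "\<And>v. v \<in># D' \<Longrightarrow> 0 \<le> L v \<and> (\<exists>E'. E' \<subseteq># D - E \<and> size E' \<le> 2 * B \<and> v = vsum E')"
      using less.hyps[of "D - E"] less.prems(1) by (meson in_diffD)
    have "vsum ({#vsum E#} + D') = vsum D"
    proof -
      have "vsum ({#vsum E#} + D') = (\<lambda>r. vsum E r + vsum (D - E) r)"
        unfolding vsum_union D'(1) by (simp add: vsum_def)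
      also have "\<dots> = vsum D" using vsum_union[of E "D - E"] D by simp
      finally show ?thesis .
    qed
    moreover have "\<exists>E. E \<subseteq># D \<and> size E \<le> 2 * B \<and> v = vsum E" if "v \<in># D'" for v
    proof -
      obtain E' where E': "E' \<subseteq># D - E" "size E' \<le> 2 * B" "v = vsum E'" using D'(2)[OF \<open>v \<in># D'\<close>] by blast
      have "E' \<subseteq># D" using E'(1) diff_subset_eq_self by (rule subset_mset.order_trans)
      then show ?thesis using E' by blast
    qed
    ultimately show ?thesis using E D'(2) by (intro exI[of _ "{#vsum E#} + D'"]) auto
  qed
qed

text \<open>The start of the induction in \<open>sign_compatible_decomposition\<close>: vectors of
  norm at most 1, with no control yet over their sums on sets.\<close>

lemma unit_decomposition:
  assumes "finite R"
  shows "\<exists>D. vsum D = (\<lambda>r. if r \<in> R then z r else 0) \<and>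
    (\<forall>v\<in>#D. \<exists>r e. v = (\<lambda>x. if x = r then e else 0) \<and> \<bar>e\<bar> \<le> 1)"
  using assms
proof (induction R)
  case empty
  show ?case by (intro exI[of _ "{#}"]) (simp add: vsum_def)
next
  case (insert r R)
  then obtain D where D: "vsum D = (\<lambda>r. if r \<in> R then z r else 0)"
    "\<And>v. v \<in># D \<Longrightarrow> \<exists>r e. v = (\<lambda>x. if x = r then e else 0) \<and> \<bar>e\<bar> \<le> 1" by auto
  let ?u = "\<lambda>x. if x = r then sgn (z r) else 0"
  let ?E = "replicate_mset (nat \<bar>z r\<bar>) ?u"
  have "vsum ?E = (\<lambda>x. if x = r then z r else 0)"
    by (auto simp: vsum_def abs_mult_sgn)
  then have "vsum (?E + D) = (\<lambda>x. if x \<in> insert r R then z x else 0)"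
    using insert.hyps(2) unfolding vsum_union D(1) by auto
  moreover have "\<exists>q e. v = (\<lambda>x. if x = q then e else 0) \<and> \<bar>e\<bar> \<le> 1" if "v \<in># ?E + D" for v
  proof (cases "v \<in># D")
    case False
    then have "v = ?u" using that by (auto split: if_splits)
    then show ?thesis by (intro exI[of _ r] exI[of _ "sgn (z r)"]) (simp add: abs_sgn_eq)
  qed (use D(2) in blast)
  ultimately show ?case by blast
qed

text \<open>One set is treated at a time. Regrouping for a new \<open>M\<close> merges at most 2B
  vectors of norm at most B, and a merged vector keeps the signs achieved before, being a sum of
  vectors that share these signs. The bound goes from B to 2B^2, so its exponent goes from e to 2e +
  1.\<close>

lemma sign_compatible_decomposition:
  fixes z :: "'a \<Rightarrow> int"
  assumes R: "finite R" and F: "finite F" "F \<subseteq> Pow R"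
  shows "\<exists>D. vsum D = (\<lambda>r. if r \<in> R then z r else 0) \<and>
    (\<forall>v\<in>#D. (\<Sum>r\<in>R. \<bar>v r\<bar>) \<le> int (2 ^ (2 ^ card F - 1))) \<and>
    (\<forall>M\<in>F. (\<forall>v\<in>#D. 0 \<le> (\<Sum>r\<in>M. v r)) \<or> (\<forall>v\<in>#D. (\<Sum>r\<in>M. v r) \<le> 0))"
  using F
proof (induction F)
  case empty
  obtain D where D: "vsum D = (\<lambda>r. if r \<in> R then z r else 0)"
    "\<And>v. v \<in># D \<Longrightarrow> \<exists>r e. v = (\<lambda>x. if x = r then e else 0) \<and> \<bar>e\<bar> \<le> 1"
    using unit_decomposition[OF R] by blast
  have "(\<Sum>r\<in>R. \<bar>v r\<bar>) \<le> 1" if v: "v \<in># D" for v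
  proof -
    obtain r e where "v = (\<lambda>x. if x = r then e else 0)" "\<bar>e\<bar> \<le> 1" using D(2)[OF v] by blast
    then show ?thesis using R by (simp add: if_distrib[of abs] cong: if_cong)
  qed
  then show ?case using D(1) by auto
next
  case (insert M F)
  let ?B = "2 ^ (2 ^ card F - 1) :: nat"
  obtain D where D: "vsum D = (\<lambda>r. if r \<in> R then z r else 0)"
    "\<And>v. v \<in># D \<Longrightarrow> (\<Sum>r\<in>R. \<bar>v r\<bar>) \<le> int ?B"
    "\<And>M. M \<in> F \<Longrightarrow> (\<forall>v\<in>#D. 0 \<le> (\<Sum>r\<in>M. v r)) \<or> (\<forall>v\<in>#D. (\<Sum>r\<in>M. v r) \<le> 0)"
    using insert by auto
  \<comment> \<open>Orients \<open>M\<close> so that the total is nonnegative, as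
    \<open>regroup_nonneg\<close> requires. For the value -1 the conclusion reads that all sums over
    \<open>M\<close> are nonpositive.\<close>
  define \<epsilon> :: int where "\<epsilon> = (if 0 \<le> (\<Sum>r\<in>M. vsum D r) then 1 else - 1)"
  define L where "L v = \<epsilon> * (\<Sum>r\<in>M. v r)" for v :: "'a \<Rightarrow> int"
  have Lbd: "\<bar>L v\<bar> \<le> int ?B" if "v \<in># D" for v
  proof -
    have "\<bar>L v\<bar> = \<bar>\<Sum>r\<in>M. v r\<bar>" unfolding L_def \<epsilon>_def by (simp add: abs_mult)
    also have "\<dots> \<le> (\<Sum>r\<in>M. \<bar>v r\<bar>)" by (rule sum_abs)
    also have "\<dots> \<le> (\<Sum>r\<in>R. \<bar>v r\<bar>)" by (rule sum_mono2) (use insert.prems R in auto)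
    finally show ?thesis using D(2)[OF that] by simp
  qed
  have "0 \<le> L (vsum D)" unfolding L_def \<epsilon>_def by auto
  moreover have "L (vsum E) = (\<Sum>v\<in>#E. L v)" for E
    unfolding L_def sum_vsum by (simp add: sum_mset_distrib_left)
  ultimately obtain D' where D': "vsum D' = vsum D" "\<And>v. v \<in># D' \<Longrightarrow> 0 \<le> L v"
    "\<And>v. v \<in># D' \<Longrightarrow> \<exists>E. E \<subseteq># D \<and> size E \<le> 2 * ?B \<and> v = vsum E"
    using regroup_nonneg[of D L ?B] Lbd by auto
  have "(\<Sum>r\<in>R. \<bar>v r\<bar>) \<le> int (2 ^ (2 ^ card (insert M F) - 1))" if v: "v \<in># D'" for v
  proof -
    obtain E where E: "E \<subseteq># D" "size E \<le> 2 * ?B" "v = vsum E" using D'(3)[OF v] by blast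
    have "(\<Sum>r\<in>R. \<bar>vsum E r\<bar>) \<le> int (size E) * int ?B"
      using E(1)
    proof (induction E)
      case (add v E)
      have "(\<Sum>r\<in>R. \<bar>vsum (add_mset v E) r\<bar>) \<le> (\<Sum>r\<in>R. \<bar>v r\<bar> + \<bar>vsum E r\<bar>)"
        by (rule sum_mono) (simp add: vsum_def)
      moreover have "E \<subseteq># D" using add.prems by (meson mset_subset_eq_insertD subset_mset.less_imp_le)
      moreover have "v \<in># D" using add.prems by (meson mset_subset_eqD union_single_eq_member)
      ultimately show ?case using add.IH D(2)[of v] by (simp add: sum.distrib algebra_simps)
    qed (simp add: vsum_def)
    also have "\<dots> \<le> int (2 * ?B) * int ?B" by (intro mult_right_mono) (use E(2) in \<open>auto simp del: of_nat_mult\<close>)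
    also have "\<dots> = int (2 ^ (2 ^ card (insert M F) - 1))"
    proof -
      have e: "1 \<le> (2 :: nat) ^ card F" by simp
      have "2 * ?B * ?B = 2 ^ (1 + (2 ^ card F - 1) + (2 ^ card F - 1))"
        by (simp only: power_add power_one_right)
      also have "1 + (2 ^ card F - 1) + (2 ^ card F - 1) = (2 :: nat) ^ card (insert M F) - 1"
        using e insert.hyps by simp
      finally show ?thesis by (simp only: flip: of_nat_mult)
    qed
    finally show ?thesis using E(3) by simp
  qed
  moreover have "(\<forall>v\<in>#D'. 0 \<le> (\<Sum>r\<in>M'. v r)) \<or> (\<forall>v\<in>#D'. (\<Sum>r\<in>M'. v r) \<le> 0)"
    if M': "M' \<in> insert M F" for M'
  proof (cases "M' = M")
    case True
    show ?thesis
    proof (cases "\<epsilon> = 1")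
      case \<epsilon>: True
      show ?thesis using D'(2) True unfolding L_def \<epsilon> by simp
    next
      case False
      then have \<epsilon>: "\<epsilon> = - 1" unfolding \<epsilon>_def by (auto split: if_splits)
      show ?thesis using D'(2) True unfolding L_def \<epsilon> by simp
    qed
  next
    case False
    have pos: "0 \<le> (\<Sum>v\<in>#E. f v)" if "\<forall>v\<in>#D. 0 \<le> f v" "E \<subseteq># D" for E and f :: "_ \<Rightarrow> int"
      using that by (intro sum_mset_nonneg_int) (auto dest: mset_subset_eqD)
    have neg: "(\<Sum>v\<in>#E. f v) \<le> 0" if "\<forall>v\<in>#D. f v \<le> 0" "E \<subseteq># D" for E and f :: "_ \<Rightarrow> int"
      using pos[of "\<lambda>v. - f v" E] that by (simp add: sum_mset_negf_int)
    show ?thesis using D(3)[of M'] M' False D'(3) pos neg by (metis insertE sum_vsum)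
  qed
  ultimately show ?case using D(1) D'(1) by auto
qed

text \<open>All subsets are made sign-compatible simultaneously. Some summand has a positive total
  because the whole vector has one. On each \<open>M\<close> the other summands share its sign, so
  its sum lies between 0 and that of \<open>z\<close>. The -1 in the exponent is dropped from the
  bound.\<close>

lemma bounded_improvement:
  fixes z :: "'a \<Rightarrow> int"
  assumes R: "finite R" and z: "0 < (\<Sum>r\<in>R. z r)"
  shows "\<exists>v. (\<Sum>r\<in>R. \<bar>v r\<bar>) \<le> int (2 ^ 2 ^ 2 ^ card R) \<and> 0 < (\<Sum>r\<in>R. v r) \<and>
    (\<forall>M\<subseteq>R. (0 \<le> (\<Sum>r\<in>M. v r) \<and> (\<Sum>r\<in>M. v r) \<le> (\<Sum>r\<in>M. z r)) \<or>
      ((\<Sum>r\<in>M. z r) \<le> (\<Sum>r\<in>M. v r) \<and> (\<Sum>r\<in>M. v r) \<le> 0))"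
proof -
  obtain D where D: "vsum D = (\<lambda>r. if r \<in> R then z r else 0)"
    "\<And>v. v \<in># D \<Longrightarrow> (\<Sum>r\<in>R. \<bar>v r\<bar>) \<le> int (2 ^ (2 ^ card (Pow R) - 1))"
    "\<And>M. M \<subseteq> R \<Longrightarrow> (\<forall>v\<in>#D. 0 \<le> (\<Sum>r\<in>M. v r)) \<or> (\<forall>v\<in>#D. (\<Sum>r\<in>M. v r) \<le> 0)"
    using sign_compatible_decomposition[OF R, of "Pow R" z] R by auto
  have row: "(\<Sum>v\<in>#D. \<Sum>r\<in>M. v r) = (\<Sum>r\<in>M. z r)" if "M \<subseteq> R" for M
    unfolding sum_vsum[symmetric] D(1) by (rule sum.cong) (use that in auto)
  have "\<exists>v\<in>#D. 0 < (\<Sum>r\<in>R. v r)"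
  proof (rule ccontr)
    assume "\<not> ?thesis"
    then have "\<forall>v\<in>#D. (\<Sum>r\<in>R. v r) \<le> 0" by auto
    then have "(\<Sum>v\<in>#D. \<Sum>r\<in>R. v r) \<le> 0" by (induction D) auto
    then show False using row[of R] z by simp
  qed
  then obtain v where v: "v \<in># D" "0 < (\<Sum>r\<in>R. v r)" by blast
  have mono: "0 \<le> f v \<and> f v \<le> (\<Sum>v\<in>#D. f v)" if "\<forall>v\<in>#D. 0 \<le> f v" for f :: "_ \<Rightarrow> int"
  proof -
    have "0 \<le> (\<Sum>u\<in>#D - {#v#}. f u)" using that
      by (intro sum_mset_nonneg_int) (auto dest: in_diffD)
    moreover have "(\<Sum>u\<in>#D. f u) = f v + (\<Sum>u\<in>#D - {#v#}. f u)"
      using v(1) by (metis image_mset_add_mset insert_DiffM sum_mset.insert)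
    ultimately show ?thesis using v(1) that by auto
  qed
  have "(0 \<le> (\<Sum>r\<in>M. v r) \<and> (\<Sum>r\<in>M. v r) \<le> (\<Sum>r\<in>M. z r)) \<or>
      ((\<Sum>r\<in>M. z r) \<le> (\<Sum>r\<in>M. v r) \<and> (\<Sum>r\<in>M. v r) \<le> 0)" if "M \<subseteq> R" for M
  proof -
    consider "\<forall>v\<in>#D. 0 \<le> (\<Sum>r\<in>M. v r)" | "\<forall>v\<in>#D. (\<Sum>r\<in>M. v r) \<le> 0" using D(3) \<open>M \<subseteq> R\<close> by blast
    then show ?thesis
    proof cases
      case 1
      then show ?thesis using mono[of "\<lambda>v. \<Sum>r\<in>M. v r"] row[OF that] by simp
    next
      case 2
      then show ?thesis using mono[of "\<lambda>v. - (\<Sum>r\<in>M. v r)"] row[OF that]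
        by (simp add: sum_mset_negf_int)
    qed
  qed
  moreover have "(\<Sum>r\<in>R. \<bar>v r\<bar>) \<le> int (2 ^ 2 ^ 2 ^ card R)"
  proof -
    have "(2 :: nat) ^ (2 ^ card (Pow R) - 1) \<le> 2 ^ 2 ^ 2 ^ card R"
      using R by (intro power_increasing) (auto simp: card_Pow)
    then show ?thesis using D(2)[OF v(1)] by linarith
  qed
  ultimately show ?thesis using v(2) by blast
qed

section \<open>Twin classes\<close>

text \<open>Elements are inserted in increasing order: the ranks of the earlier ones do not change,
  and the new one has rank \<open>card A\<close>.\<close>

lemma card_initial_segment:
  fixes A :: "nat set"
  assumes "finite A"
  shows "card {v \<in> A. card {u \<in> A. u < v} < m} = min m (card A)"
  using assms
proof (induction A rule: finite_linorder_max_induct)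
  case empty
  then show ?case by simp
next
  case (insert b A)
  define f where "f v = card {u \<in> insert b A. u < v}" for v
  define g where "g v = card {u \<in> A. u < v}" for v
  have "{u \<in> insert b A. u < v} = {u \<in> A. u < v}" if "v \<in> A" for v
    using insert.hyps(2) that by force
  then have fg: "f v = g v" if "v \<in> A" for v using that by (simp add: f_def g_def)
  have "{u \<in> insert b A. u < b} = A" using insert.hyps(2) by auto
  then have fb: "f b = card A" by (simp add: f_def)
  have "{v \<in> insert b A. f v < m} = {v \<in> A. g v < m} \<union> (if card A < m then {b} else {})"
    using fg fb by auto
  moreover have "b \<notin> A" using insert.hyps(2) by blast
  ultimately show ?case using insert.IH insert.hyps(1) unfolding f_def[symmetric] g_def[symmetric]
    by (auto simp: min_def)
qed

locale twin_graph =
  fixes n :: nat and adj :: "nat \<Rightarrow> nat \<Rightarrow> bool"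
  assumes adj_sym: "adj u v \<Longrightarrow> adj v u"
    and adj_irrefl: "\<not> adj u u"
    and adj_dom: "adj u v \<Longrightarrow> u < n \<and> v < n"
begin

definition tw :: "nat \<Rightarrow> nat \<Rightarrow> bool" where
  "tw u v \<longleftrightarrow> (\<forall>x<n. x \<noteq> u \<longrightarrow> x \<noteq> v \<longrightarrow> adj u x = adj v x)"

text \<open>The least twin is chosen so that a scan in increasing order meets it as its first
  hit.\<close>

definition rp :: "nat \<Rightarrow> nat" where
  "rp v = (LEAST u. u < n \<and> tw u v)"

definition reps :: "nat set" where
  "reps = {v. v < n \<and> rp v = v}"

definition cl :: "nat \<Rightarrow> nat set" where
  "cl r = {v. v < n \<and> rp v = r}"

definition sz :: "nat \<Rightarrow> nat" where
  "sz r = card (cl r)"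

definition rk :: "nat \<Rightarrow> nat" where
  "rk v = card {u. u < v \<and> rp u = rp v}"

text \<open>Any \<open>y r\<close> vertices of class \<open>r\<close> would do; taking the first
  ones makes membership a comparison of numbers. A value above the class size stands for the whole
  class.\<close>

definition kept :: "(nat \<Rightarrow> nat) \<Rightarrow> nat set" where
  "kept y = {v. v < n \<and> rk v < y (rp v)}"

definition clo :: "nat \<Rightarrow> nat set \<Rightarrow> bool" where
  "clo c K \<longleftrightarrow> (\<forall>u\<in>K. \<forall>v\<in>K. u \<noteq> v \<longrightarrow> \<not> adj u v \<longrightarrow> card {x \<in> K. adj u x \<and> adj v x} < c)"

lemma adj_commute: "adj u v \<longleftrightarrow> adj v u"
  using adj_sym by blast

lemma twD: "tw u v \<Longrightarrow> x \<noteq> u \<Longrightarrow> x \<noteq> v \<Longrightarrow> adj u x = adj v x"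
  unfolding tw_def using adj_dom by blast

lemma tw_refl: "tw u u"
  by (simp add: tw_def)

lemma tw_sym: "tw u v \<Longrightarrow> tw v u"
  by (auto simp: tw_def)

lemma tw_trans:
  assumes "tw u v" "tw v w"
  shows "tw u w"
  unfolding tw_def
proof (intro allI impI)
  fix x assume x: "x < n" "x \<noteq> u" "x \<noteq> w"
  show "adj u x = adj w x"
  proof (cases "x = v")
    case False
    then show ?thesis using twD[OF assms(1), of x] twD[OF assms(2), of x] x by simp
  next
    case True
    then show ?thesis using twD[OF assms(2), of u] twD[OF assms(1), of w] x adj_commute by (cases "u = w") auto
  qed
qed

lemma rp_props:
  assumes "v < n"
  shows "rp v < n" "tw (rp v) v"
  using LeastI[of "\<lambda>u. u < n \<and> tw u v" v] assms tw_refl unfolding rp_def by auto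

lemma rp_eq_iff:
  assumes "u < n" "v < n"
  shows "rp u = rp v \<longleftrightarrow> tw u v"
proof
  assume "rp u = rp v"
  then show "tw u v" using rp_props assms tw_sym tw_trans by metis
next
  assume "tw u v"
  then have "tw x u \<longleftrightarrow> tw x v" for x using tw_sym tw_trans by blast
  then show "rp u = rp v" by (simp add: rp_def)
qed

lemma rp_reps: "v < n \<Longrightarrow> rp v \<in> reps"
  unfolding reps_def using rp_props[of v] rp_eq_iff[of "rp v" v] by auto

lemma finite_reps: "finite reps"
  by (simp add: reps_def)

lemma finite_cl: "finite (cl r)"
  by (simp add: cl_def)

lemma kept_sub: "kept y \<subseteq> {..<n}"
  by (auto simp: kept_def)

lemma kept_cong: "(\<And>r. r \<in> reps \<Longrightarrow> y r = y' r) \<Longrightarrow> kept y = kept y'"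
  unfolding kept_def using rp_reps by auto

lemma card_kept_cl: "card (kept y \<inter> cl r) = min (y r) (sz r)"
proof -
  have "kept y \<inter> cl r = {v \<in> cl r. card {u \<in> cl r. u < v} < y r}"
  proof -
    have "{u. u < v \<and> rp u = rp v} = {u \<in> cl r. u < v}" if "v \<in> cl r" for v
      using that by (auto simp: cl_def)
    then show ?thesis by (auto simp: kept_def cl_def rk_def)
  qed
  then show ?thesis using card_initial_segment[OF finite_cl] by (simp add: sz_def)
qed

lemma card_by_class:
  assumes "K \<subseteq> {..<n}" "M \<subseteq> reps"
  shows "card {x \<in> K. rp x \<in> M} = (\<Sum>r\<in>M. card (K \<inter> cl r))"
proof -
  have "{x \<in> K. rp x \<in> M} = (\<Union>r\<in>M. K \<inter> cl r)"
    using assms by (auto simp: cl_def)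
  moreover have "card (\<Union>r\<in>M. K \<inter> cl r) = (\<Sum>r\<in>M. card (K \<inter> cl r))"
    by (rule card_UN_disjoint) (use assms finite_reps finite_subset finite_cl in \<open>auto simp: cl_def\<close>)
  ultimately show ?thesis by simp
qed

lemma card_all_classes:
  assumes "K \<subseteq> {..<n}"
  shows "card K = (\<Sum>r\<in>reps. card (K \<inter> cl r))"
proof -
  have "{x \<in> K. rp x \<in> reps} = K" using assms rp_reps by auto
  then show ?thesis using card_by_class[OF assms subset_refl] by simp
qed

text \<open>The only danger is that \<open>x'\<close> is \<open>u\<close> or \<open>v\<close>
  itself. If \<open>x'\<close> were \<open>u\<close>, then \<open>v\<close>, being adjacent to
  \<open>x\<close>, would be adjacent to its twin \<open>u\<close>.\<close>

lemma common_nbrs_closed: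
  assumes "u \<noteq> v" "\<not> adj u v" "adj u x" "adj v x" "tw x x'"
  shows "adj u x' \<and> adj v x'"
proof -
  have "u \<noteq> x" "v \<noteq> x" using assms adj_irrefl by auto
  have "u \<noteq> x'"
    using twD[OF assms(5), of v] assms \<open>v \<noteq> x\<close> adj_commute by blast
  moreover have "v \<noteq> x'"
    using twD[OF assms(5), of u] assms \<open>u \<noteq> x\<close> adj_commute by blast
  ultimately show ?thesis
    using twD[OF assms(5), of v] twD[OF assms(5), of u] assms(3,4) \<open>u \<noteq> x\<close> \<open>v \<noteq> x\<close> adj_commute by blast
qed

lemma card_common_nbrs:
  assumes "K \<subseteq> {..<n}" "u \<noteq> v" "\<not> adj u v"
  shows "card {x \<in> K. adj u x \<and> adj v x} = (\<Sum>r\<in>{r \<in> reps. adj u r \<and> adj v r}. card (K \<inter> cl r))"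
proof -
  have "adj u x \<and> adj v x \<longleftrightarrow> adj u (rp x) \<and> adj v (rp x)" if "x \<in> K" for x
  proof -
    have "tw (rp x) x" "tw x (rp x)" using that assms(1) rp_props tw_sym by auto
    then show ?thesis using common_nbrs_closed[OF assms(2,3)] by blast
  qed
  then have "{x \<in> K. adj u x \<and> adj v x} = {x \<in> K. rp x \<in> {r \<in> reps. adj u r \<and> adj v r}}"
    using assms(1) rp_reps by auto
  then show ?thesis using card_by_class[OF assms(1), of "{r \<in> reps. adj u r \<and> adj v r}"] by auto
qed

text \<open>The endpoints are exchanged one at a time. This breaks down if the intermediate pair
  \<open>u'\<close>, \<open>v\<close> coincides; then \<open>u\<close> and \<open>v'\<close> are
  twins, and a single exchange is enough.\<close>

lemma twin_pair_adj:
  assumes "tw u u'" "tw v v'" "u \<noteq> v" "u' \<noteq> v'" "adj u v"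
  shows "adj u' v'"
proof (cases "v = u'")
  case False
  then have "adj u' v" using twD[OF assms(1), of v] assms by blast
  then show ?thesis using twD[OF assms(2), of u'] assms False adj_commute by blast
next
  case True
  then have "tw u v'" using assms tw_trans by blast
  then show ?thesis using twD[of u v' u'] assms True adj_commute by blast
qed

text \<open>Again \<open>x\<close> cannot be one of the new endpoints, because that would make
  \<open>u\<close> and \<open>v\<close> adjacent. Applied in both directions, this shows that the
  common neighbours depend only on the two classes.\<close>

lemma twin_pair_common_nbrs:
  assumes "tw u u'" "tw v v'" "u \<noteq> v" "u' \<noteq> v'" "\<not> adj u v" "adj u x" "adj v x"
  shows "adj u' x \<and> adj v' x"
proof -
  have "x \<noteq> u" "x \<noteq> v" using assms adj_irrefl by auto
  have "x \<noteq> u'" using twD[OF assms(1), of v] assms \<open>x \<noteq> v\<close> adj_commute by blast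
  have "x \<noteq> v'" using twD[OF assms(2), of u] assms \<open>x \<noteq> u\<close> adj_commute by blast
  show ?thesis using twD[OF assms(1), of x] twD[OF assms(2), of x] assms(6,7)
      \<open>x \<noteq> u\<close> \<open>x \<noteq> v\<close> \<open>x \<noteq> u'\<close> \<open>x \<noteq> v'\<close> by blast
qed

text \<open>The reason for truncating at 2: a pair inside one class needs two vertices of that class
  in \<open>K\<close>, and a pair from two classes needs one vertex of each.\<close>

lemma lift_pair:
  assumes "K' \<subseteq> {..<n}" "K \<subseteq> {..<n}" "\<And>r. r \<in> reps \<Longrightarrow> min 2 (card (K' \<inter> cl r)) \<le> card (K \<inter> cl r)"
    and uv: "u \<in> K'" "v \<in> K'" "u \<noteq> v"
  obtains u' v' where "u' \<in> K" "v' \<in> K" "u' \<noteq> v'" "tw u u'" "tw v v'"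
proof -
  have uvn: "u < n" "v < n" using assms by auto
  have tw: "tw w w'" if "w < n" "w' \<in> K \<inter> cl (rp w)" for w w'
    using that rp_eq_iff[of w w'] by (auto simp: cl_def)
  show ?thesis
  proof (cases "rp u = rp v")
    case True
    have "card {u, v} \<le> card (K' \<inter> cl (rp u))"
      by (rule card_mono) (use True uv uvn finite_cl in \<open>auto simp: cl_def\<close>)
    then have "2 \<le> card (K \<inter> cl (rp u))" using assms(3)[of "rp u"] rp_reps uvn uv(3) by auto
    then obtain a b where "a \<in> K \<inter> cl (rp u)" "b \<in> K \<inter> cl (rp u)" "a \<noteq> b"
      using card_le_Suc0_iff_eq[of "K \<inter> cl (rp u)"] finite_cl[of "rp u"] by auto
    then show ?thesis using that[of a b] tw[of u a] tw[of v b] uvn True by auto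
  next
    case False
    have ne: "\<exists>a. a \<in> K \<inter> cl (rp w)" if "w \<in> K'" "w < n" for w
    proof -
      have "card {w} \<le> card (K' \<inter> cl (rp w))"
        by (rule card_mono) (use that finite_cl in \<open>auto simp: cl_def\<close>)
      then have "1 \<le> card (K \<inter> cl (rp w))" using assms(3)[of "rp w"] rp_reps that by fastforce
      then show ?thesis by (metis card.empty ex_in_conv not_one_le_zero)
    qed
    obtain a b where "a \<in> K \<inter> cl (rp u)" "b \<in> K \<inter> cl (rp v)" using ne uv uvn by blast
    moreover from this have "a \<noteq> b" using False by (auto simp: cl_def)
    ultimately show ?thesis using that[of a b] tw[of u a] tw[of v b] uvn by auto
  qed
qed

text \<open>Every pair in \<open>K'\<close> has a twin pair in \<open>K1\<close> and another in
  \<open>K2\<close>, with the same set \<open>M\<close> of common neighbour classes. Which of the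
  two sets bounds the sum over \<open>M\<close> may vary with \<open>M\<close>; this is the form
  needed for a point between two solutions.\<close>

lemma clo_transfer:
  assumes sub: "K' \<subseteq> {..<n}" "K1 \<subseteq> {..<n}" "K2 \<subseteq> {..<n}" and "clo c K1" "clo c K2"
    and p1: "\<And>r. r \<in> reps \<Longrightarrow> min 2 (card (K' \<inter> cl r)) \<le> card (K1 \<inter> cl r)"
    and p2: "\<And>r. r \<in> reps \<Longrightarrow> min 2 (card (K' \<inter> cl r)) \<le> card (K2 \<inter> cl r)"
    and le: "\<And>M. M \<subseteq> reps \<Longrightarrow> (\<Sum>r\<in>M. card (K' \<inter> cl r)) \<le>
      max (\<Sum>r\<in>M. card (K1 \<inter> cl r)) (\<Sum>r\<in>M. card (K2 \<inter> cl r))"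
  shows "clo c K'"
  unfolding clo_def
proof (intro ballI impI)
  fix u v assume uv: "u \<in> K'" "v \<in> K'" "u \<noteq> v" "\<not> adj u v"
  let ?M = "{r \<in> reps. adj u r \<and> adj v r}"
  have *: "(\<Sum>r\<in>?M. card (K \<inter> cl r)) < c"
    if K: "K \<subseteq> {..<n}" "clo c K" and p: "\<And>r. r \<in> reps \<Longrightarrow> min 2 (card (K' \<inter> cl r)) \<le> card (K \<inter> cl r)" for K
  proof -
    obtain u' v' where u': "u' \<in> K" "v' \<in> K" "u' \<noteq> v'" "tw u u'" "tw v v'"
      using lift_pair[OF sub(1) K(1) p uv(1,2,3)] by blast
    have na: "\<not> adj u' v'" using twin_pair_adj[of u' u v' v] u' uv tw_sym by blast
    have "{r \<in> reps. adj u' r \<and> adj v' r} = ?M"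
      using twin_pair_common_nbrs[of u u' v v'] twin_pair_common_nbrs[of u' u v' v] u' uv na tw_sym by blast
    then show ?thesis using card_common_nbrs[OF K(1) u'(3) na] K(2) u' na unfolding clo_def by metis
  qed
  have "?M \<subseteq> reps" by auto
  then show "card {x \<in> K'. adj u x \<and> adj v x} < c"
    using le[of ?M] *[OF sub(2) assms(4) p1] *[OF sub(3) assms(5) p2] card_common_nbrs[OF sub(1) uv(3,4)]
    by simp
qed

section \<open>Improving moves on class counts\<close>

definition bd :: nat where "bd = 2 ^ 2 ^ 2 ^ card reps"

text \<open>\<open>w\<close> acts through \<open>min (w r) 2\<close>. The bound by the class size
  makes the counts exact, so that \<open>card (kept y)\<close> is their sum.\<close>

definition patt :: "(nat \<Rightarrow> nat) \<Rightarrow> (nat \<Rightarrow> nat) \<Rightarrow> bool" where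
  "patt w y \<longleftrightarrow> (\<forall>r\<in>reps. y r \<le> sz r \<and> min (y r) 2 = min (w r) 2)"

lemma card_kept: 
  assumes "patt w y"
  shows "card (kept y) = (\<Sum>r\<in>reps. y r)" "\<And>r. r \<in> reps \<Longrightarrow> card (kept y \<inter> cl r) = y r"
proof -
  show *: "\<And>r. r \<in> reps \<Longrightarrow> card (kept y \<inter> cl r) = y r"
    using assms by (simp add: card_kept_cl patt_def)
  then show "card (kept y) = (\<Sum>r\<in>reps. y r)" using card_all_classes[OF kept_sub] by simp
qed

lemma patt_min2:
  assumes "patt w y" "patt w y'" "r \<in> reps"
  shows "min 2 (y r) \<le> y' r"
proof -
  have "min (y r) 2 = min (y' r) 2" using assms by (simp add: patt_def)
  then show ?thesis by linarith
qed

lemma improving_move: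
  assumes y: "patt w y" "clo c (kept y)" and ys: "patt w ys" "clo c (kept ys)"
    and lt: "card (kept y) < card (kept ys)"
  shows "\<exists>y'. patt w y' \<and> clo c (kept y') \<and> card (kept y) < card (kept y') \<and>
    (\<forall>r\<in>reps. y' r \<le> y r + bd \<and> y r \<le> y' r + bd)"
proof -
  define z where "z r = int (ys r) - int (y r)" for r
  have "0 < (\<Sum>r\<in>reps. z r)"
    using lt card_kept(1)[OF y(1)] card_kept(1)[OF ys(1)]
    by (simp add: z_def sum_subtractf flip: of_nat_sum)
  then obtain v where v: "(\<Sum>r\<in>reps. \<bar>v r\<bar>) \<le> int bd" "0 < (\<Sum>r\<in>reps. v r)"
    "\<And>M. M \<subseteq> reps \<Longrightarrow> (0 \<le> (\<Sum>r\<in>M. v r) \<and> (\<Sum>r\<in>M. v r) \<le> (\<Sum>r\<in>M. z r)) \<or>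
      ((\<Sum>r\<in>M. z r) \<le> (\<Sum>r\<in>M. v r) \<and> (\<Sum>r\<in>M. v r) \<le> 0)"
    using bounded_improvement[OF finite_reps, of z] unfolding bd_def by blast
  define y' where "y' r = nat (int (y r) + v r)" for r
  \<comment> \<open>Singletons show that each coordinate of the new point lies between those of
    \<open>y\<close> and \<open>ys\<close>. Hence \<open>nat\<close> truncates nothing in
    \<open>y'\<close>, and class sizes and pattern are respected.\<close>
  have vr: "0 \<le> v r \<and> v r \<le> z r \<or> z r \<le> v r \<and> v r \<le> 0" if "r \<in> reps" for r
    using v(3)[of "{r}"] that by simp
  have y': "int (y' r) = int (y r) + v r" if "r \<in> reps" for r
    using vr[OF that] unfolding y'_def z_def by linarith
  have pt: "patt w y'"
    unfolding patt_def
  proof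
    fix r assume r: "r \<in> reps"
    have a: "y r \<le> sz r" "min (y r) 2 = min (w r) 2" "ys r \<le> sz r" "min (ys r) 2 = min (w r) 2"
      using y(1) ys(1) r by (auto simp: patt_def)
    have b: "y r \<le> y' r \<and> y' r \<le> ys r \<or> ys r \<le> y' r \<and> y' r \<le> y r"
      using vr[OF r] y'[OF r] unfolding z_def by linarith
    show "y' r \<le> sz r \<and> min (y' r) 2 = min (w r) 2"
      using a b by (auto simp: min_def split: if_splits)
  qed
  have sumy': "int (\<Sum>r\<in>M. y' r) = int (\<Sum>r\<in>M. y r) + (\<Sum>r\<in>M. v r)" if "M \<subseteq> reps" for M
  proof -
    have "int (\<Sum>r\<in>M. y' r) = (\<Sum>r\<in>M. int (y r) + v r)"
      unfolding of_nat_sum by (rule sum.cong) (use y' that in auto)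
    then show ?thesis by (simp add: sum.distrib)
  qed
  have "clo c (kept y')"
  proof (rule clo_transfer[OF kept_sub kept_sub kept_sub y(2) ys(2)])
    show "min 2 (card (kept y' \<inter> cl r)) \<le> card (kept y \<inter> cl r)" if "r \<in> reps" for r
      using patt_min2[OF pt y(1) that] card_kept(2)[OF pt that] card_kept(2)[OF y(1) that] by simp
    show "min 2 (card (kept y' \<inter> cl r)) \<le> card (kept ys \<inter> cl r)" if "r \<in> reps" for r
      using patt_min2[OF pt ys(1) that] card_kept(2)[OF pt that] card_kept(2)[OF ys(1) that] by simp
    fix M assume M: "M \<subseteq> reps"
    have eq: "(\<Sum>r\<in>M. card (kept x \<inter> cl r)) = (\<Sum>r\<in>M. x r)" if "patt w x" for x
      by (rule sum.cong) (use that M card_kept(2) in auto)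
    have "(\<Sum>r\<in>M. z r) = int (\<Sum>r\<in>M. ys r) - int (\<Sum>r\<in>M. y r)"
      by (simp add: z_def sum_subtractf)
    then have "(\<Sum>r\<in>M. y' r) \<le> max (\<Sum>r\<in>M. y r) (\<Sum>r\<in>M. ys r)"
      using v(3)[OF M] sumy'[OF M] by linarith
    then show "(\<Sum>r\<in>M. card (kept y' \<inter> cl r)) \<le>
        max (\<Sum>r\<in>M. card (kept y \<inter> cl r)) (\<Sum>r\<in>M. card (kept ys \<inter> cl r))"
      using eq[OF pt] eq[OF y(1)] eq[OF ys(1)] by simp
  qed
  moreover have "card (kept y) < card (kept y')"
    using card_kept(1)[OF y(1)] card_kept(1)[OF pt] sumy'[OF subset_refl] v(2) by linarith
  moreover have "y' r \<le> y r + bd \<and> y r \<le> y' r + bd" if r: "r \<in> reps" for r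
  proof -
    have "\<bar>v r\<bar> \<le> (\<Sum>r\<in>reps. \<bar>v r\<bar>)"
      by (rule member_le_sum) (use r finite_reps in auto)
    then show ?thesis using v(1) y'[OF r] by linarith
  qed
  ultimately show ?thesis using pt by blast
qed

text \<open>A starting point with the right pattern costs no search: cutting the counts of a
  solution down to at most 2 keeps the pattern and increases no sum, so the truncated vector is
  itself closed.\<close>

lemma initial_pattern:
  assumes K: "K \<subseteq> {..<n}" "clo c K"
  obtains w ys where "patt w ys" "clo c (kept ys)" "card (kept ys) = card K"
    "patt w w" "clo c (kept w)" "\<And>r. w r \<le> 2"
proof -
  define ys where "ys r = card (K \<inter> cl r)" for r
  define w where "w r = min (ys r) 2" for r
  have ysz: "ys r \<le> sz r" for r unfolding ys_def sz_def by (rule card_mono) (auto simp: finite_cl)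
  have p: "patt w ys" "patt w w"
    using ysz by (auto simp: patt_def w_def min.coboundedI1)
  have "clo c (kept ys)"
    by (rule clo_transfer[OF kept_sub K(1) K(1) K(2) K(2)])
      (auto simp: card_kept(2)[OF p(1)] ys_def intro!: sum_mono)
  moreover have "clo c (kept w)"
    by (rule clo_transfer[OF kept_sub K(1) K(1) K(2) K(2)])
      (auto simp: card_kept(2)[OF p(2)] ys_def w_def intro!: sum_mono)
  moreover have "card (kept ys) = card K"
    using card_kept(1)[OF p(1)] card_all_classes[OF K(1)] by (simp add: ys_def)
  ultimately show ?thesis using that[of w ys] p by (simp add: w_def)
qed

section \<open>Enumerating the moves\<close>

text \<open>A digit from 0 to 2 * \<open>bd\<close> stands for a change of a count by an amount from
  -\<open>bd\<close> to \<open>bd\<close>.\<close>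

definition bs :: nat where "bs = bd + bd + 1"

definition NN :: nat where "NN = bs ^ card reps"

text \<open>The position of a digit is the index of its representative among all representatives, so
  that p digits suffice whatever the vertex numbers are.\<close>

definition dg :: "nat \<Rightarrow> nat \<Rightarrow> nat" where
  "dg q v = (q div bs ^ card {u \<in> reps. u < v}) mod bs"

text \<open>A digit can thus also hold a truncated count 0, 1 or 2, which lets the same numbers
  enumerate the patterns.\<close>

lemma bs_gt: "bs > 2"
proof -
  have "(2::nat) ^ 1 \<le> bd" unfolding bd_def by (intro power_increasing) auto
  then show ?thesis by (simp add: bs_def)
qed

lemma card_reps_Suc: "card {u \<in> reps. u < Suc m} = card {u \<in> reps. u < m} + (if m \<in> reps then 1 else 0)"
proof -
  have "{u \<in> reps. u < Suc m} = {u \<in> reps. u < m} \<union> (if m \<in> reps then {m} else {})"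
    by (auto simp: less_Suc_eq)
  then show ?thesis using finite_reps by auto
qed

text \<open>Representatives are added in increasing order. Each takes a new leading digit, which
  contributes a multiple of \<open>bs\<close> at every lower position and so leaves the lower digits
  as they were.\<close>

lemma dg_surj:
  assumes "\<And>r. r \<in> reps \<Longrightarrow> t r < bs"
  shows "\<exists>q<NN. \<forall>r\<in>reps. dg q r = t r"
proof -
  have "\<exists>q < bs ^ card {u \<in> reps. u < m}. \<forall>r\<in>reps. r < m \<longrightarrow> dg q r = t r" for m
  proof (induction m)
    case 0
    then show ?case by auto
  next
    case (Suc m)
    then obtain q where q: "q < bs ^ card {u \<in> reps. u < m}" "\<And>r. r \<in> reps \<Longrightarrow> r < m \<Longrightarrow> dg q r = t r" by blast
    show ?case
    proof (cases "m \<in> reps")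
      case False
      then show ?thesis using q card_reps_Suc[of m] by (auto simp: less_Suc_eq)
    next
      case True
      let ?k = "card {u \<in> reps. u < m}"
      let ?q = "q + t m * bs ^ ?k"
      have "?q < bs ^ Suc ?k"
      proof -
        have "?q < bs ^ ?k + t m * bs ^ ?k" using q(1) by simp
        also have "\<dots> = Suc (t m) * bs ^ ?k" by simp
        also have "\<dots> \<le> bs * bs ^ ?k" using assms[OF True] by (intro mult_le_mono1) simp
        finally show ?thesis by simp
      qed
      moreover have "dg ?q r = t r" if r: "r \<in> reps" "r < Suc m" for r
      proof (cases "r = m")
        case True
        have "?q div bs ^ ?k = t m" using q(1) bs_gt by (subst div_mult_self1) auto
        then show ?thesis using assms[OF r(1)] True by (simp add: dg_def)
      next
        case False
        let ?j = "card {u \<in> reps. u < r}"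
        have "?j < ?k"
        proof (rule psubset_card_mono)
          have "r \<in> {u \<in> reps. u < m}" "r \<notin> {u \<in> reps. u < r}" using r False by auto
          moreover have "{u \<in> reps. u < r} \<subseteq> {u \<in> reps. u < m}" using r by auto
          ultimately show "{u \<in> reps. u < r} \<subset> {u \<in> reps. u < m}" by blast
        qed (simp add: finite_reps)
        then obtain d where d: "?k = ?j + Suc d" using less_imp_Suc_add by fastforce
        have "?q = q + (t m * bs ^ Suc d) * bs ^ ?j" by (simp add: d power_add mult.assoc)
        moreover have "(q + (t m * bs ^ Suc d) * bs ^ ?j) div bs ^ ?j = t m * bs ^ Suc d + q div bs ^ ?j"
          by (rule div_mult_self1) (use bs_gt in simp)
        ultimately have "?q div bs ^ ?j = t m * bs ^ Suc d + q div bs ^ ?j" by (simp only:)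
        moreover have "t m * bs ^ Suc d = (t m * bs ^ d) * bs" by simp
        ultimately have "?q div bs ^ ?j = (t m * bs ^ d) * bs + q div bs ^ ?j" by (simp only:)
        then have "dg ?q r = dg q r" by (simp add: dg_def)
        then show ?thesis using q(2) r False by auto
      qed
      ultimately show ?thesis using card_reps_Suc[of m] True by auto
    qed
  qed
  from this[of n] have "\<exists>q < bs ^ card {u \<in> reps. u < n}. \<forall>r\<in>reps. r < n \<longrightarrow> dg q r = t r" .
  moreover have "{u \<in> reps. u < n} = reps" by (auto simp: reps_def)
  ultimately show ?thesis unfolding NN_def by (auto simp: reps_def)
qed

text \<open>Truncated subtraction turns a negative count into 0. The result is one more candidate
  and is tested like all others.\<close>

definition move :: "(nat \<Rightarrow> nat) \<Rightarrow> nat \<Rightarrow> nat \<Rightarrow> nat" where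
  "move y q = (\<lambda>r. y r + dg q r - bd)"

lemma move_surj:
  assumes "\<And>r. r \<in> reps \<Longrightarrow> y' r \<le> y r + bd \<and> y r \<le> y' r + bd"
  shows "\<exists>q<NN. \<forall>r\<in>reps. move y q r = y' r"
proof -
  have "\<exists>q<NN. \<forall>r\<in>reps. dg q r = y' r + bd - y r"
    by (rule dg_surj) (use assms in \<open>fastforce simp: bs_def\<close>)
  then obtain q where q: "q < NN" "\<And>r. r \<in> reps \<Longrightarrow> dg q r = y' r + bd - y r" by blast
  have "move y q r = y' r" if "r \<in> reps" for r
    using q(2)[OF that] assms[OF that] by (simp add: move_def)
  then show ?thesis using q(1) by blast
qed

lemma patt_cong: "(\<And>r. r \<in> reps \<Longrightarrow> y r = y' r) \<Longrightarrow> patt w y = patt w y'"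
  by (auto simp: patt_def)

text \<open>If \<open>y\<close> is worse than \<open>ys\<close>, an improving move exists; otherwise
  \<open>y\<close> already keeps enough vertices, and the zero move exhibits it.
  \<open>\<beta>\<close> is the value recorded by the program, which may be below the true one
  because it starts at 0.\<close>

lemma progress:
  assumes y: "patt w y" "clo c (kept y)" and ys: "patt w ys" "clo c (kept ys)"
    and k: "n \<le> card (kept ys) + k" and \<beta>: "\<beta> \<le> card (kept y)"
  shows "\<exists>q<NN. clo c (kept (move y q)) \<and> (n \<le> card (kept (move y q)) + k \<or>
    patt w (move y q) \<and> \<beta> < card (kept (move y q)))"
proof -
  have "\<exists>y'. patt w y' \<and> clo c (kept y') \<and> (n \<le> card (kept y') + k \<or> card (kept y) < card (kept y')) \<and>
    (\<forall>r\<in>reps. y' r \<le> y r + bd \<and> y r \<le> y' r + bd)"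
  proof (cases "card (kept y) < card (kept ys)")
    case True
    then show ?thesis using improving_move[OF y ys] by blast
  next
    case False
    then show ?thesis using y k by (intro exI[of _ y]) auto
  qed
  then obtain y' where y': "patt w y'" "clo c (kept y')" "n \<le> card (kept y') + k \<or> card (kept y) < card (kept y')"
    "\<And>r. r \<in> reps \<Longrightarrow> y' r \<le> y r + bd \<and> y r \<le> y' r + bd" by blast
  obtain q where q: "q < NN" "\<And>r. r \<in> reps \<Longrightarrow> move y q r = y' r" using move_surj[of y' y] y'(4) by blast
  have "kept (move y q) = kept y'" "patt w (move y q) = patt w y'"
    using kept_cong q(2) patt_cong by blast+
  then show ?thesis using y' q(1) \<beta> by (metis le_less_trans)
qed

end

section \<open>The program\<close>

text \<open>Registers 0 and 1 carry the input and 2 the constant c. Number 3 is skipped since it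
  holds the array base, and all numbers stay below 30.\<close>

abbreviation (input) "r_n \<equiv> 0 :: nat"
abbreviation (input) "r_k \<equiv> 1 :: nat"
abbreviation (input) "r_c \<equiv> 2 :: nat"
abbreviation (input) "r_p \<equiv> 4 :: nat"
abbreviation (input) "r_N \<equiv> 5 :: nat"
abbreviation (input) "r_g \<equiv> 6 :: nat"
abbreviation (input) "r_b \<equiv> 7 :: nat"
abbreviation (input) "r_ans \<equiv> 8 :: nat"
abbreviation (input) "r_u \<equiv> 9 :: nat"
abbreviation (input) "r_v \<equiv> 10 :: nat"
abbreviation (input) "r_x \<equiv> 11 :: nat"
abbreviation (input) "r_un \<equiv> 12 :: nat"
abbreviation (input) "r_vn \<equiv> 13 :: nat"
abbreviation (input) "r_f \<equiv> 14 :: nat"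
abbreviation (input) "r_cnt \<equiv> 15 :: nat"
abbreviation (input) "r_q \<equiv> 16 :: nat"
abbreviation (input) "r_h \<equiv> 17 :: nat"
abbreviation (input) "r_val \<equiv> 18 :: nat"
abbreviation (input) "r_best \<equiv> 19 :: nat"
abbreviation (input) "r_w \<equiv> 20 :: nat"
abbreviation (input) "r_pass \<equiv> 21 :: nat"
abbreviation (input) "r_m \<equiv> 22 :: nat"
abbreviation (input) "r_bad \<equiv> 23 :: nat"
abbreviation (input) "r_i \<equiv> 24 :: nat"
abbreviation (input) "r_n1 \<equiv> 25 :: nat"
abbreviation (input) "r_t1 \<equiv> 26 :: nat"
abbreviation (input) "r_t2 \<equiv> 27 :: nat"
abbreviation (input) "r_s \<equiv> 28 :: nat"
abbreviation (input) "a_rep \<equiv> 0 :: nat"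
abbreviation (input) "a_rank \<equiv> 1 :: nat"
abbreviation (input) "a_sz \<equiv> 2 :: nat"
abbreviation (input) "a_y \<equiv> 3 :: nat"
abbreviation (input) "a_cand \<equiv> 4 :: nat"
abbreviation (input) "a_w \<equiv> 5 :: nat"
abbreviation (input) "a_keep \<equiv> 6 :: nat"
abbreviation (input) "a_d \<equiv> 7 :: nat"

abbreviation (input) "When e c \<equiv> Cond e c Skip"
abbreviation (input) "Unless e c \<equiv> Cond e Skip c"

text \<open>A test is a number, with 0 for false, and truncated subtraction provides all tests.
  \<open>Ne\<close> is the absolute difference.\<close>

definition Ne :: "exp \<Rightarrow> exp \<Rightarrow> exp" where "Ne a b = Pl (Mi a b) (Mi b a)"

definition Lt :: "exp \<Rightarrow> exp \<Rightarrow> exp" where "Lt a b = Mi b a"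

definition Min2 :: "exp \<Rightarrow> exp" where "Min2 a = Mi a (Mi a (Cn 2))"

lemma derived_exp [simp]:
  "eval (Ne a b) s = 0 \<longleftrightarrow> eval a s = eval b s"
  "0 < eval (Ne a b) s \<longleftrightarrow> eval a s \<noteq> eval b s"
  "eval (Lt a b) s = 0 \<longleftrightarrow> eval b s \<le> eval a s"
  "0 < eval (Lt a b) s \<longleftrightarrow> eval a s < eval b s"
  "eval (Min2 a) s = min (eval a s) 2"
  "wfe (Ne a b) \<longleftrightarrow> wfe a \<and> wfe b" "wfe (Lt a b) \<longleftrightarrow> wfe a \<and> wfe b" "wfe (Min2 a) \<longleftrightarrow> wfe a"
  by (auto simp: Ne_def Lt_def Min2_def)

abbreviation (input) seq_com (infixr \<open>;;\<close> 60) where "c ;; d \<equiv> Sq c d"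

declare exe.simps(5) [simp del]
declare vr_exe [simp] ar_exe [simp] inp_exe [simp]

lemma card_less_Suc: "card {u. u < Suc j \<and> P u} = card {u. u < j \<and> P u} + (if P j then 1 else 0)"
proof -
  have "{u. u < Suc j \<and> P u} = {u. u < j \<and> P u} \<union> (if P j then {j} else {})"
    by (auto simp: less_Suc_eq)
  then show ?thesis by simp
qed

section \<open>Computing representatives, ranks and class sizes\<close>

definition tw_loop :: com where
  "tw_loop = For r_x r_n (When (Ne (V r_x) (V r_u)) (When (Ne (V r_x) (V r_v))
     (When (Ne (In (Pl (V r_un) (V r_x))) (In (Pl (V r_vn) (V r_x)))) (Asg r_f (Cn 1)))))"

text \<open>\<open>r_cnt\<close> is a flag here: once a twin has been found, later ones are ignored.
  The row offset \<open>r_un\<close> advances by n in each round, since the machine has no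
  multiplication.\<close>

definition rep_loop :: com where
  "rep_loop = For r_u r_n (Asg r_f (Cn 0) ;; tw_loop ;;
     Unless (V r_f) (Unless (V r_cnt) (St a_rep (V r_v) (V r_u) ;; Asg r_cnt (Cn 1))) ;;
     Asg r_un (Pl (V r_un) (V r_n)))"

definition rep_all :: com where
  "rep_all = For r_v r_n (Asg r_un (Cn 0) ;; Asg r_cnt (Cn 0) ;; rep_loop ;;
     Asg r_vn (Pl (V r_vn) (V r_n)))"

definition rank_loop :: com where
  "rank_loop = For r_u r_n (Unless (Ne (Ld a_rep (V r_u)) (Ld a_rep (V r_v)))
     (Asg r_s (Pl (V r_s) (Cn 1)) ;; When (Lt (V r_u) (V r_v)) (Asg r_cnt (Pl (V r_cnt) (Cn 1)))))"

text \<open>\<open>r_p\<close> counts the vertices that represent themselves. This number of classes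
  is the argument of the tower of powers computed afterwards.\<close>

definition rank_all :: com where
  "rank_all = For r_v r_n (Asg r_s (Cn 0) ;; Asg r_cnt (Cn 0) ;; rank_loop ;;
     St a_rank (V r_v) (V r_cnt) ;; St a_sz (V r_v) (V r_s) ;;
     Unless (Ne (Ld a_rep (V r_v)) (V r_v)) (Asg r_p (Pl (V r_p) (Cn 1))))"

lemma assigned_preparation [simp]:
  "asg tw_loop = [r_x, r_f]" "sto tw_loop = []"
  "asg rep_loop = [r_u, r_f, r_x, r_f, r_cnt, r_un]" "sto rep_loop = [a_rep]"
  "asg rank_loop = [r_u, r_s, r_cnt]" "sto rank_loop = []"
  by (simp_all add: tw_loop_def rep_loop_def rank_loop_def)

context twin_graph
begin

definition graph_in :: "st \<Rightarrow> bool" where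
  "graph_in s \<longleftrightarrow> vr s r_n = n \<and> (\<forall>u<n. \<forall>v<n. inp s (u * n + v) = (if adj u v then 1 else 0))"

lemma graph_inD: "graph_in s \<Longrightarrow> u < n \<Longrightarrow> v < n \<Longrightarrow> inp s (u * n + v) = (if adj u v then 1 else 0)"
  by (simp add: graph_in_def)

lemma tw_loop:
  assumes "graph_in s" "vr s r_u = u" "vr s r_v = v" "vr s r_un = u * n" "vr s r_vn = v * n" "u < n" "v < n"
    "vr s r_f = 0"
  shows "vr (exe tw_loop s) r_f = 0 \<longleftrightarrow> tw u v"
proof -
  have n: "vr s r_n = n" using assms by (simp add: graph_in_def)
  let ?I = "\<lambda>j t. vr t r_f = 0 \<longleftrightarrow> (\<forall>x<j. x \<noteq> u \<longrightarrow> x \<noteq> v \<longrightarrow> adj u x = adj v x)"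
  have "?I (vr s r_n) (exe tw_loop s)"
    unfolding tw_loop_def
  proof (rule For_rule[where I = ?I], goal_cases)
    case 1
    then show ?case using assms by simp
  next
    case (2 j t)
    have "graph_in t" using assms(1) 2 by (simp add: graph_in_def)
    then have "inp t (u * n + j) = (if adj u j then 1 else 0)" "inp t (v * n + j) = (if adj v j then 1 else 0)"
      using 2(1) n assms(6,7) graph_inD by auto
    then show ?case using 2 assms by (auto simp: less_Suc_eq)
  qed
  then show ?thesis by (simp add: tw_def n)
qed

text \<open>As long as the flag is 0 no twin has been met, so the first hit is the least one. A hit
  is certain because \<open>v\<close> is its own twin.\<close>

lemma rep_loop:
  assumes "graph_in s" "vr s r_v = v" "vr s r_un = 0" "vr s r_vn = v * n" "v < n" "vr s r_cnt = 0"
  shows "ar (exe rep_loop s) a_rep = (ar s a_rep)(v := rp v)"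
proof -
  have n: "vr s r_n = n" using assms by (simp add: graph_in_def)
  let ?I = "\<lambda>j t. vr t r_un = j * n \<and>
      (if vr t r_cnt = 0 then (\<forall>u<j. \<not> tw u v) \<and> ar t a_rep = ar s a_rep
       else ar t a_rep = (ar s a_rep)(v := rp v))"
  have "?I (vr s r_n) (exe rep_loop s)"
    unfolding rep_loop_def
  proof (rule For_rule[where I = ?I], goal_cases)
    case 1
    then show ?case using assms by simp
  next
    case (2 j t)
    have f: "vr (exe tw_loop (set_var r_f 0 t)) r_f = 0 \<longleftrightarrow> tw j v"
      by (rule tw_loop) (use 2 assms n in \<open>simp_all add: graph_in_def\<close>)
    have "rp v = j" if "tw j v" "\<forall>u<j. \<not> tw u v"
      unfolding rp_def by (rule Least_equality) (use that 2(1) n in \<open>auto simp: not_less[symmetric]\<close>)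
    then show ?case using 2 assms n f by (auto simp: less_Suc_eq split: if_splits)
  qed
  then show ?thesis using tw_refl[of v] assms(5) n by (auto split: if_splits)
qed

lemma rep_all:
  assumes "graph_in s" "vr s r_vn = 0" "v < n"
  shows "ar (exe rep_all s) a_rep v = rp v"
proof -
  have n: "vr s r_n = n" using assms by (simp add: graph_in_def)
  let ?I = "\<lambda>j t. vr t r_vn = j * n \<and> (\<forall>v<j. ar t a_rep v = rp v)"
  have "?I (vr s r_n) (exe rep_all s)"
    unfolding rep_all_def
  proof (rule For_rule[where I = ?I], goal_cases)
    case 1
    then show ?case using assms by simp
  next
    case (2 j t)
    have "ar (exe rep_loop (set_var r_cnt 0 (set_var r_un 0 t))) a_rep = (ar (set_var r_cnt 0 (set_var r_un 0 t)) a_rep)(j := rp j)"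
      by (rule rep_loop) (use 2 assms n in \<open>simp_all add: graph_in_def\<close>)
    then show ?case using 2 assms n by (auto simp: less_Suc_eq)
  qed
  then show ?thesis using assms n by simp
qed

lemma rank_loop:
  assumes "vr s r_n = n" "vr s r_v = v" "v < n" "vr s r_cnt = 0" "vr s r_s = 0"
    "\<And>v. v < n \<Longrightarrow> ar s a_rep v = rp v"
  shows "vr (exe rank_loop s) r_cnt = rk v" "vr (exe rank_loop s) r_s = sz (rp v)"
proof -
  let ?I = "\<lambda>j t. vr t r_cnt = card {u. u < j \<and> (u < v \<and> rp u = rp v)} \<and> vr t r_s = card {u. u < j \<and> rp u = rp v}"
  have "?I (vr s r_n) (exe rank_loop s)"
    unfolding rank_loop_def
  proof (rule For_rule[where I = ?I], goal_cases)
    case 1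
    then show ?case using assms by simp
  next
    case (2 j t)
    then show ?case using assms by (auto simp: card_less_Suc)
  qed
  moreover have "{u. u < n \<and> (u < v \<and> rp u = rp v)} = {u. u < v \<and> rp u = rp v}" using assms(3) by auto
  ultimately show "vr (exe rank_loop s) r_cnt = rk v" "vr (exe rank_loop s) r_s = sz (rp v)"
    using assms(1) by (simp_all add: rk_def sz_def cl_def)
qed

lemma rank_all:
  assumes "vr s r_n = n" "vr s r_p = 0" "\<And>v. v < n \<Longrightarrow> ar s a_rep v = rp v"
  shows "v < n \<Longrightarrow> ar (exe rank_all s) a_rank v = rk v" "v < n \<Longrightarrow> ar (exe rank_all s) a_sz v = sz (rp v)"
    "vr (exe rank_all s) r_p = card reps"
proof -
  let ?I = "\<lambda>j t. (\<forall>v<j. ar t a_rank v = rk v \<and> ar t a_sz v = sz (rp v)) \<and> vr t r_p = card {v. v < j \<and> rp v = v}"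
  have "?I (vr s r_n) (exe rank_all s)"
    unfolding rank_all_def
  proof (rule For_rule[where I = ?I], goal_cases)
    case 1
    then show ?case using assms by simp
  next
    case (2 j t)
    have "vr (exe rank_loop (set_var r_cnt 0 (set_var r_s 0 t))) r_cnt = rk j"
      "vr (exe rank_loop (set_var r_cnt 0 (set_var r_s 0 t))) r_s = sz (rp j)"
      by (rule rank_loop; use 2 assms in simp)+
    then show ?case using 2 assms by (auto simp: All_less_Suc card_less_Suc)
  qed
  then show "v < n \<Longrightarrow> ar (exe rank_all s) a_rank v = rk v" "v < n \<Longrightarrow> ar (exe rank_all s) a_sz v = sz (rp v)"
    "vr (exe rank_all s) r_p = card reps"
    using assms(1) by (simp_all add: reps_def)
qed

end

section \<open>Decoding, testing and accepting a candidate\<close>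

definition div_loop :: com where
  "div_loop = For r_i r_N (Unless (Lt (V r_q) (V r_b))
     (Asg r_q (Mi (V r_q) (V r_b)) ;; Asg r_h (Pl (V r_h) (Cn 1))))"

text \<open>Digits are peeled off from the low end in the order of the representatives, in
  accordance with the positions in \<open>dg\<close>. Other cells of \<open>a_d\<close> keep stale
  contents; all later tests read the counts at representatives.\<close>

definition dec_loop :: com where
  "dec_loop = For r_v r_n (Unless (Ne (Ld a_rep (V r_v)) (V r_v))
     (Asg r_h (Cn 0) ;; div_loop ;; St a_d (V r_v) (V r_q) ;; Asg r_q (V r_h)))"

definition init_loop :: com where
  "init_loop = For r_v r_n (St a_y (V r_v) (Ld a_d (V r_v)) ;; St a_w (V r_v) (Ld a_d (V r_v)))"

definition cand_loop :: com where
  "cand_loop = For r_v r_n (St a_cand (V r_v) (Mi (Pl (Ld a_y (V r_v)) (Ld a_d (V r_v))) (V r_g)) ;;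
     Unless (Ne (Ld a_rep (V r_v)) (V r_v))
       (When (Lt (Ld a_sz (V r_v)) (Ld a_cand (V r_v))) (Asg r_bad (Cn 1)) ;;
        When (Ne (Min2 (Ld a_cand (V r_v))) (Min2 (Ld a_w (V r_v)))) (Asg r_bad (Cn 1))))"

definition keep_loop :: com where
  "keep_loop = For r_v r_n (Cond (Lt (Ld a_rank (V r_v)) (Ld a_cand (Ld a_rep (V r_v))))
     (St a_keep (V r_v) (Cn 1) ;; Asg r_val (Pl (V r_val) (Cn 1))) (St a_keep (V r_v) (Cn 0)))"

definition count_loop :: com where
  "count_loop = For r_x r_n (When (Ld a_keep (V r_x)) (When (In (Pl (V r_un) (V r_x)))
     (When (In (Pl (V r_vn) (V r_x))) (Asg r_cnt (Pl (V r_cnt) (Cn 1))))))"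

definition row_loop :: com where
  "row_loop = For r_v r_n (When (Ld a_keep (V r_u)) (When (Ld a_keep (V r_v))
     (When (Ne (V r_u) (V r_v)) (Unless (In (Pl (V r_un) (V r_v)))
       (Asg r_cnt (Cn 0) ;; count_loop ;; Unless (Lt (V r_cnt) (V r_c)) (Asg r_f (Cn 0)))))) ;;
     Asg r_vn (Pl (V r_vn) (V r_n)))"

definition closed_loop :: com where
  "closed_loop = For r_u r_n (Asg r_vn (Cn 0) ;; row_loop ;; Asg r_un (Pl (V r_un) (V r_n)))"

definition copy_loop :: com where
  "copy_loop = For r_v r_n (St a_y (V r_v) (Ld a_cand (V r_v)))"

text \<open>The answer is set even if the candidate violates the pattern, since any sufficiently
  large closed set certifies it. The pattern restricts only which candidates may become the current
  point.\<close>

definition update :: com where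
  "update = When (V r_f) (Unless (Lt (Pl (V r_val) (V r_k)) (V r_n)) (Asg r_ans (Cn 1)) ;;
     Unless (V r_bad) (When (Lt (V r_best) (V r_val)) (Asg r_best (V r_val) ;; copy_loop)))"

definition body :: com where
  "body = Asg r_q (V r_m) ;; dec_loop ;; Asg r_bad (Cn 0) ;; cand_loop ;; Asg r_val (Cn 0) ;; keep_loop ;;
     Asg r_f (Cn 1) ;; Asg r_un (Cn 0) ;; closed_loop ;; update"

definition inner_loop :: com where
  "inner_loop = For r_m r_N body"

definition search_loop :: com where
  "search_loop = For r_pass r_n1 inner_loop"

definition main_loop :: com where
  "main_loop = For r_w r_N (Asg r_q (V r_w) ;; dec_loop ;; init_loop ;; Asg r_best (Cn 0) ;; search_loop)"

lemma assigned_loops [simp]: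
  "asg div_loop = [r_i, r_q, r_h]" "sto div_loop = []"
  "asg dec_loop = [r_v, r_h, r_i, r_q, r_h, r_q]" "sto dec_loop = [a_d]"
  "asg init_loop = [r_v]" "sto init_loop = [a_y, a_w]"
  "asg cand_loop = [r_v, r_bad, r_bad]" "sto cand_loop = [a_cand]"
  "asg keep_loop = [r_v, r_val]" "sto keep_loop = [a_keep, a_keep]"
  "asg count_loop = [r_x, r_cnt]" "sto count_loop = []"
  "asg row_loop = [r_v, r_cnt, r_x, r_cnt, r_f, r_vn]" "sto row_loop = []"
  "asg closed_loop = [r_u, r_vn, r_v, r_cnt, r_x, r_cnt, r_f, r_vn, r_un]" "sto closed_loop = []"
  "asg copy_loop = [r_v]" "sto copy_loop = [a_y]"
  "asg update = [r_ans, r_best, r_v]" "sto update = [a_y]"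
  by (simp_all add: div_loop_def dec_loop_def init_loop_def cand_loop_def keep_loop_def count_loop_def
      row_loop_def closed_loop_def copy_loop_def update_def)

lemma assigned_search [simp]:
  "set (asg body) = {r_u, r_v, r_x, r_un, r_vn, r_f, r_cnt, r_q, r_h, r_val, r_best, r_ans, r_bad, r_i}"
  "set (sto body) = {a_d, a_cand, a_keep, a_y}"
  "set (asg inner_loop) = {r_m, r_u, r_v, r_x, r_un, r_vn, r_f, r_cnt, r_q, r_h, r_val, r_best, r_ans, r_bad, r_i}"
  "set (sto inner_loop) = {a_d, a_cand, a_keep, a_y}"
  "set (asg search_loop) = {r_pass, r_m, r_u, r_v, r_x, r_un, r_vn, r_f, r_cnt, r_q, r_h, r_val, r_best, r_ans, r_bad, r_i}"
  "set (sto search_loop) = {a_d, a_cand, a_keep, a_y}"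
proof -
  show b: "set (asg body) = {r_u, r_v, r_x, r_un, r_vn, r_f, r_cnt, r_q, r_h, r_val, r_best, r_ans, r_bad, r_i}"
    "set (sto body) = {a_d, a_cand, a_keep, a_y}" unfolding body_def by (simp; blast)+
  show i: "set (asg inner_loop) = {r_m, r_u, r_v, r_x, r_un, r_vn, r_f, r_cnt, r_q, r_h, r_val, r_best, r_ans, r_bad, r_i}"
    "set (sto inner_loop) = {a_d, a_cand, a_keep, a_y}" by (simp_all add: inner_loop_def b)
  show "set (asg search_loop) = {r_pass, r_m, r_u, r_v, r_x, r_un, r_vn, r_f, r_cnt, r_q, r_h, r_val, r_best, r_ans, r_bad, r_i}"
    "set (sto search_loop) = {a_d, a_cand, a_keep, a_y}" by (simp_all add: search_loop_def i)
qed

text \<open>Division by repeated subtraction in a fixed number of rounds, idle once the remainder is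
  below \<open>B\<close>. Since each active round lowers \<open>r_q\<close> by at least 1,
  \<open>Q\<close> rounds are enough.\<close>

lemma div_loop:
  assumes "vr s r_b = B" "B > 0" "vr s r_h = 0" "vr s r_q = Q" "Q \<le> vr s r_N"
  shows "vr (exe div_loop s) r_q = Q mod B" "vr (exe div_loop s) r_h = Q div B"
proof -
  let ?I = "\<lambda>j t. Q = vr t r_h * B + vr t r_q \<and> (vr t r_q < B \<or> vr t r_h = j)"
  have "?I (vr s r_N) (exe div_loop s)"
    unfolding div_loop_def
  proof (rule For_rule[where I = ?I], goal_cases)
    case 1
    then show ?case using assms by simp
  next
    case (2 j t)
    then show ?case using assms by (auto simp: algebra_simps)
  qed
  then obtain h q where hq: "h = vr (exe div_loop s) r_h" "q = vr (exe div_loop s) r_q"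
    "Q = h * B + q" "q < B \<or> h = vr s r_N" by simp
  have "q < B"
  proof (rule ccontr)
    assume "\<not> q < B"
    then have "h * 1 \<le> h * B" "h = vr s r_N" "0 < q" using hq(4) assms(2) by (auto intro: mult_le_mono2)
    then show False using hq(3) assms(5) by linarith
  qed
  then have "Q mod B = q" "Q div B = h" unfolding hq(3) by simp_all
  then show "vr (exe div_loop s) r_q = Q mod B" "vr (exe div_loop s) r_h = Q div B" using hq by simp_all
qed

context twin_graph
begin

section \<open>Correctness of the treatment of one candidate\<close>

definition prep :: "st \<Rightarrow> bool" where
  "prep s \<longleftrightarrow> graph_in s \<and> (\<forall>v<n. ar s a_rep v = rp v \<and> ar s a_rank v = rk v \<and> ar s a_sz v = sz (rp v)) \<and>
     vr s r_N = NN \<and> vr s r_g = bd \<and> vr s r_b = bs"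

text \<open>Everything in \<open>prep\<close> lives in registers, arrays and input cells that the
  search never writes, so it survives each loop by the frame rules.\<close>

lemma prep_frame:
  assumes "prep s" "\<And>y. y \<in> {r_n, r_N, r_g, r_b} \<Longrightarrow> vr t y = vr s y"
    "\<And>a. a \<in> {a_rep, a_rank, a_sz} \<Longrightarrow> ar t a = ar s a" "inp t = inp s"
  shows "prep t"
  using assms by (simp add: prep_def graph_in_def)

lemma prepD:
  assumes "prep s"
  shows "vr s r_n = n" "vr s r_N = NN" "vr s r_g = bd" "vr s r_b = bs"
    "v < n \<Longrightarrow> ar s a_rep v = rp v" "v < n \<Longrightarrow> ar s a_rank v = rk v" "v < n \<Longrightarrow> ar s a_sz v = sz (rp v)"
    "u < n \<Longrightarrow> v < n \<Longrightarrow> inp s (u * n + v) = (if adj u v then 1 else 0)"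
  using assms by (simp_all add: prep_def graph_in_def)

lemma dec_loop:
  assumes S: "prep s" and q: "vr s r_q = Q" "Q < NN" and r: "r \<in> reps"
  shows "ar (exe dec_loop s) a_d r = dg Q r"
proof -
  let ?I = "\<lambda>j t. vr t r_q = Q div bs ^ card {u \<in> reps. u < j} \<and> (\<forall>r\<in>reps. r < j \<longrightarrow> ar t a_d r = dg Q r)"
  have "?I (vr s r_n) (exe dec_loop s)"
    unfolding dec_loop_def
  proof (rule For_rule[where I = ?I], goal_cases)
    case 1
    then show ?case using q by simp
  next
    case (2 j t)
    have St: "prep t" by (rule prep_frame[OF S]) (use 2 in auto)
    have jn: "j < n" using 2(1) prepD[OF S] by simp
    have rep: "ar t a_rep j = rp j" using prepD(5)[OF St jn] .
    show ?case
    proof (cases "j \<in> reps")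
      case False
      then have "rp j \<noteq> j" using jn by (simp add: reps_def)
      then show ?thesis using 2 rep False card_reps_Suc[of j] by (auto simp: less_Suc_eq simp del: power_Suc)
    next
      case True
      then have rj: "rp j = j" by (simp add: reps_def)
      let ?k = "card {u \<in> reps. u < j}"
      \<comment> \<open>\<open>div_loop\<close> runs for \<open>NN\<close> rounds, so its argument
        must not exceed \<open>NN\<close>; a quotient of \<open>Q\<close> does not.\<close>
      have "Q div bs ^ ?k \<le> vr t r_N"
        using q(2) prepD(2)[OF St] by (simp, meson div_le_dividend le_less_trans less_imp_le)
      then have d: "vr (exe div_loop (set_var r_h 0 t)) r_q = (Q div bs ^ ?k) mod bs"
        "vr (exe div_loop (set_var r_h 0 t)) r_h = (Q div bs ^ ?k) div bs"
        using div_loop[of "set_var r_h 0 t" bs "Q div bs ^ ?k"] 2(3) prepD(4)[OF St] bs_gt by simp_all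
      have "(Q div bs ^ ?k) div bs = Q div bs ^ card {u \<in> reps. u < Suc j}"
        using True card_reps_Suc[of j] by (simp add: div_mult2_eq[symmetric] mult.commute)
      then show ?thesis using 2 rep rj d by (auto simp: less_Suc_eq dg_def)
    qed
  qed
  then show ?thesis using r prepD(1)[OF S] by (simp add: reps_def)
qed

lemma init_loop:
  assumes "vr s r_n = n" "v < n"
  shows "ar (exe init_loop s) a_y v = ar s a_d v" "ar (exe init_loop s) a_w v = ar s a_d v"
proof -
  let ?I = "\<lambda>j t. \<forall>v<j. ar t a_y v = ar s a_d v \<and> ar t a_w v = ar s a_d v"
  have "?I (vr s r_n) (exe init_loop s)"
    unfolding init_loop_def
  proof (rule For_rule[where I = ?I], goal_cases)
    case (2 j t)
    then show ?case by (auto simp: less_Suc_eq)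
  qed simp
  then show "ar (exe init_loop s) a_y v = ar s a_d v" "ar (exe init_loop s) a_w v = ar s a_d v" using assms by auto
qed

lemma copy_loop:
  assumes "vr s r_n = n" "v < n"
  shows "ar (exe copy_loop s) a_y v = ar s a_cand v"
proof -
  let ?I = "\<lambda>j t. \<forall>v<j. ar t a_y v = ar s a_cand v"
  have "?I (vr s r_n) (exe copy_loop s)"
    unfolding copy_loop_def
  proof (rule For_rule[where I = ?I], goal_cases)
    case (2 j t)
    then show ?case by (auto simp: less_Suc_eq)
  qed simp
  then show ?thesis using assms by auto
qed

lemma cand_loop:
  assumes S: "prep s" and "vr s r_bad = 0"
  shows "v < n \<Longrightarrow> ar (exe cand_loop s) a_cand v = ar s a_y v + ar s a_d v - bd"
    "vr (exe cand_loop s) r_bad = 0 \<longleftrightarrow> patt (ar s a_w) (\<lambda>v. ar s a_y v + ar s a_d v - bd)"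
proof -
  let ?Y = "\<lambda>v. ar s a_y v + ar s a_d v - bd"
  let ?I = "\<lambda>j t. (\<forall>v<j. ar t a_cand v = ?Y v) \<and>
      (vr t r_bad = 0 \<longleftrightarrow> (\<forall>r<j. r \<in> reps \<longrightarrow> ?Y r \<le> sz r \<and> min (?Y r) 2 = min (ar s a_w r) 2))"
  have "?I (vr s r_n) (exe cand_loop s)"
    unfolding cand_loop_def
  proof (rule For_rule[where I = ?I], goal_cases)
    case 1
    then show ?case using assms by simp
  next
    case (2 j t)
    have St: "prep t" by (rule prep_frame[OF S]) (use 2 in auto)
    have jn: "j < n" using 2(1) prepD[OF S] by simp
    have rep: "rp j = j \<longleftrightarrow> j \<in> reps" using jn by (simp add: reps_def)
    have f: "ar t a_y j = ar s a_y j" "ar t a_d j = ar s a_d j" "ar t a_w j = ar s a_w j" "vr t r_g = bd"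
      using 2 prepD(3)[OF St] by auto
    show ?case
      using 2(2,3) f prepD(5,7)[OF St jn] rep
      by (cases "j \<in> reps") (auto simp: All_less_Suc)
  qed
  then show "v < n \<Longrightarrow> ar (exe cand_loop s) a_cand v = ?Y v"
    "vr (exe cand_loop s) r_bad = 0 \<longleftrightarrow> patt (ar s a_w) ?Y"
    unfolding prepD(1)[OF S] patt_def by (auto simp: reps_def)
qed

lemma keep_loop:
  assumes S: "prep s" and "vr s r_val = 0"
  shows "v < n \<Longrightarrow> ar (exe keep_loop s) a_keep v = (if v \<in> kept (ar s a_cand) then 1 else 0)"
    "vr (exe keep_loop s) r_val = card (kept (ar s a_cand))"
proof -
  let ?P = "\<lambda>v. rk v < ar s a_cand (rp v)"
  let ?I = "\<lambda>j t. (\<forall>v<j. ar t a_keep v = (if ?P v then 1 else 0)) \<and> vr t r_val = card {v. v < j \<and> ?P v}"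
  have "?I (vr s r_n) (exe keep_loop s)"
    unfolding keep_loop_def
  proof (rule For_rule[where I = ?I], goal_cases)
    case 1
    then show ?case using assms by simp
  next
    case (2 j t)
    have St: "prep t" by (rule prep_frame[OF S]) (use 2 in auto)
    have jn: "j < n" using 2(1) prepD[OF S] by simp
    have "ar t a_cand = ar s a_cand" using 2 by auto
    then show ?case using 2(2,3) prepD(5,6)[OF St jn] by (auto simp: All_less_Suc card_less_Suc)
  qed
  then show "v < n \<Longrightarrow> ar (exe keep_loop s) a_keep v = (if v \<in> kept (ar s a_cand) then 1 else 0)"
    "vr (exe keep_loop s) r_val = card (kept (ar s a_cand))"
    unfolding prepD(1)[OF S] kept_def by auto
qed

lemma count_loop:
  assumes S: "prep s" and "vr s r_cnt = 0" "vr s r_un = u * n" "vr s r_vn = v * n" "u < n" "v < n"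
    and K: "\<And>x. x < n \<Longrightarrow> ar s a_keep x \<noteq> 0 \<longleftrightarrow> x \<in> K" "K \<subseteq> {..<n}"
  shows "vr (exe count_loop s) r_cnt = card {x \<in> K. adj u x \<and> adj v x}"
proof -
  let ?I = "\<lambda>j t. vr t r_cnt = card {x. x < j \<and> (x \<in> K \<and> adj u x \<and> adj v x)}"
  have "?I (vr s r_n) (exe count_loop s)"
    unfolding count_loop_def
  proof (rule For_rule[where I = ?I], goal_cases)
    case 1
    then show ?case using assms by simp
  next
    case (2 j t)
    have St: "prep t" by (rule prep_frame[OF S]) (use 2 in auto)
    have jn: "j < n" using 2(1) prepD[OF S] by simp
    have "ar t a_keep j \<noteq> 0 \<longleftrightarrow> j \<in> K" "vr t r_un = u * n" "vr t r_vn = v * n" using 2 assms(3,4) K(1)[OF jn] by auto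
    then show ?case using 2(2,3) prepD(8)[OF St assms(5) jn] prepD(8)[OF St assms(6) jn]
      by (auto simp: card_less_Suc)
  qed
  moreover have "{x. x < n \<and> (x \<in> K \<and> adj u x \<and> adj v x)} = {x \<in> K. adj u x \<and> adj v x}" using K(2) by auto
  ultimately show ?thesis unfolding prepD(1)[OF S] by simp
qed

lemma row_loop:
  assumes S: "prep s" and "vr s r_u = u" "vr s r_un = u * n" "vr s r_vn = 0" "u < n"
    and K: "\<And>x. x < n \<Longrightarrow> ar s a_keep x \<noteq> 0 \<longleftrightarrow> x \<in> K" "K \<subseteq> {..<n}"
  shows "vr (exe row_loop s) r_f \<noteq> 0 \<longleftrightarrow> vr s r_f \<noteq> 0 \<and>
    (\<forall>v<n. u \<in> K \<longrightarrow> v \<in> K \<longrightarrow> u \<noteq> v \<longrightarrow> \<not> adj u v \<longrightarrow> card {x \<in> K. adj u x \<and> adj v x} < vr s r_c)"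
proof -
  let ?I = "\<lambda>j t. vr t r_vn = j * n \<and> (vr t r_f \<noteq> 0 \<longleftrightarrow> vr s r_f \<noteq> 0 \<and>
    (\<forall>v<j. u \<in> K \<longrightarrow> v \<in> K \<longrightarrow> u \<noteq> v \<longrightarrow> \<not> adj u v \<longrightarrow> card {x \<in> K. adj u x \<and> adj v x} < vr s r_c))"
  have "?I (vr s r_n) (exe row_loop s)"
    unfolding row_loop_def
  proof (rule For_rule[where I = ?I], goal_cases)
    case 1
    then show ?case using assms by simp
  next
    case (2 j t)
    have St: "prep t" by (rule prep_frame[OF S]) (use 2 in auto)
    have jn: "j < n" using 2(1) prepD[OF S] by simp
    have k: "ar t a_keep = ar s a_keep" and f: "vr t r_un = u * n" "vr t r_u = u" "vr t r_c = vr s r_c" "vr t r_n = n"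
      using 2 assms prepD(1)[OF S] by auto
    have c: "vr (exe count_loop (set_var r_cnt 0 t)) r_cnt = card {x \<in> K. adj u x \<and> adj j x}"
    proof (rule count_loop)
      show "prep (set_var r_cnt 0 t)" by (rule prep_frame[OF St]) auto
    qed (use 2(3) f k K jn assms(5) in simp_all)
    show ?case using 2(2,3) f c K(1)[OF jn] K(1)[OF assms(5)] prepD(8)[OF St assms(5) jn]
      unfolding k[symmetric] by (auto simp: All_less_Suc)
  qed
  then show ?thesis unfolding prepD(1)[OF S] by simp
qed

lemma closed_loop:
  assumes S: "prep s" and "vr s r_un = 0" "vr s r_f \<noteq> 0"
    and K: "\<And>x. x < n \<Longrightarrow> ar s a_keep x \<noteq> 0 \<longleftrightarrow> x \<in> K" "K \<subseteq> {..<n}"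
  shows "vr (exe closed_loop s) r_f \<noteq> 0 \<longleftrightarrow> clo (vr s r_c) K"
proof -
  let ?I = "\<lambda>j t. vr t r_un = j * n \<and> (vr t r_f \<noteq> 0 \<longleftrightarrow>
    (\<forall>u<j. \<forall>v<n. u \<in> K \<longrightarrow> v \<in> K \<longrightarrow> u \<noteq> v \<longrightarrow> \<not> adj u v \<longrightarrow> card {x \<in> K. adj u x \<and> adj v x} < vr s r_c))"
  have "?I (vr s r_n) (exe closed_loop s)"
    unfolding closed_loop_def
  proof (rule For_rule[where I = ?I], goal_cases)
    case 1
    then show ?case using assms by simp
  next
    case (2 j t)
    have St: "prep t" by (rule prep_frame[OF S]) (use 2 in auto)
    have jn: "j < n" using 2(1) prepD[OF S] by simp
    have k: "ar t a_keep = ar s a_keep" and f: "vr t r_c = vr s r_c" "vr t r_n = n"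
      using 2 prepD(1)[OF S] by auto
    have "vr (exe row_loop (set_var r_vn 0 t)) r_f \<noteq> 0 \<longleftrightarrow> vr (set_var r_vn 0 t) r_f \<noteq> 0 \<and>
      (\<forall>v<n. j \<in> K \<longrightarrow> v \<in> K \<longrightarrow> j \<noteq> v \<longrightarrow> \<not> adj j v \<longrightarrow>
        card {x \<in> K. adj j x \<and> adj v x} < vr (set_var r_vn 0 t) r_c)"
    proof (rule row_loop)
      show "prep (set_var r_vn 0 t)" by (rule prep_frame[OF St]) auto
    qed (use 2(2,3) k K jn in simp_all)
    then show ?case using 2(2,3) f by (simp add: All_less_Suc) blast
  qed
  then show ?thesis unfolding prepD(1)[OF S] clo_def using K(2) by (auto simp: subset_iff)
qed

end

context twin_graph
begin

lemma patt_cong_left: "(\<And>r. r \<in> reps \<Longrightarrow> w r = w' r) \<Longrightarrow> patt w y = patt w' y"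
  by (auto simp: patt_def)

lemma reps_less: "r \<in> reps \<Longrightarrow> r < n"
  by (simp add: reps_def)

text \<open>The new point agrees with \<open>Y\<close> at representatives only. This suffices
  because \<open>kept\<close> and \<open>patt\<close> read the counts there. Certifying an answer
  and moving the current point are separate effects, hence the separate conclusions.\<close>

lemma body:
  assumes S: "prep s" and m: "vr s r_m < NN"
  defines "Y \<equiv> move (ar s a_y) (vr s r_m)"
  shows "vr (exe body s) r_ans =
      (if clo (vr s r_c) (kept Y) \<and> n \<le> card (kept Y) + vr s r_k then 1 else vr s r_ans)"
    and "clo (vr s r_c) (kept Y) \<and> patt (ar s a_w) Y \<and> vr s r_best < card (kept Y) \<Longrightarrow>
      vr (exe body s) r_best = card (kept Y) \<and> (\<forall>r\<in>reps. ar (exe body s) a_y r = Y r)"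
    and "\<not> (clo (vr s r_c) (kept Y) \<and> patt (ar s a_w) Y \<and> vr s r_best < card (kept Y)) \<Longrightarrow>
      vr (exe body s) r_best = vr s r_best \<and> ar (exe body s) a_y = ar s a_y"
proof -
  define s0 where "s0 = set_var r_q (vr s r_m) s"
  define s1 where "s1 = set_var r_bad 0 (exe dec_loop s0)"
  define s2 where "s2 = set_var r_val 0 (exe cand_loop s1)"
  define s3 where "s3 = set_var r_un 0 (set_var r_f 1 (exe keep_loop s2))"
  define s4 where "s4 = exe closed_loop s3"
  have e: "exe body s = exe update s4"
    by (simp add: body_def s0_def s1_def s2_def s3_def s4_def)
  have S0: "prep s0" by (rule prep_frame[OF S]) (auto simp: s0_def)
  have S1: "prep s1" by (rule prep_frame[OF S0]) (auto simp: s1_def)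
  have S2: "prep s2" by (rule prep_frame[OF S1]) (auto simp: s2_def)
  have S3: "prep s3" by (rule prep_frame[OF S2]) (auto simp: s3_def)
  have S4: "prep s4" by (rule prep_frame[OF S3]) (auto simp: s4_def)
  let ?Y1 = "\<lambda>v. ar s1 a_y v + ar s1 a_d v - bd"
  have d: "ar s1 a_d r = dg (vr s r_m) r" if "r \<in> reps" for r
    using dec_loop[OF S0 _ m that] by (simp add: s1_def s0_def)
  have y1: "ar s1 a_y = ar s a_y" "ar s1 a_w = ar s a_w" by (simp_all add: s1_def s0_def)
  have Y1: "?Y1 r = Y r" if "r \<in> reps" for r using d[OF that] y1 by (simp add: Y_def move_def)
  have cand: "ar s2 a_cand r = Y r" if "r \<in> reps" for r
    using cand_loop(1)[OF S1, of r] that Y1[OF that] reps_less by (simp add: s2_def) (simp add: s1_def)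
  have bad: "vr s2 r_bad = 0 \<longleftrightarrow> patt (ar s a_w) Y"
    using cand_loop(2)[OF S1] patt_cong[of ?Y1 Y "ar s a_w"] Y1 y1 by (simp add: s2_def) (simp add: s1_def)
  have K: "kept (ar s2 a_cand) = kept Y" by (rule kept_cong) (use cand in auto)
  have keep: "ar s3 a_keep v \<noteq> 0 \<longleftrightarrow> v \<in> kept Y" if "v < n" for v
    using keep_loop(1)[OF S2 _ that] K by (simp add: s3_def) (simp add: s2_def)
  have val: "vr s3 r_val = card (kept Y)"
    using keep_loop(2)[OF S2] K by (simp add: s3_def) (simp add: s2_def)
  have f: "vr s4 r_f \<noteq> 0 \<longleftrightarrow> clo (vr s3 r_c) (kept Y)"
    unfolding s4_def by (rule closed_loop[OF S3 _ _ keep kept_sub]) (simp_all add: s3_def)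
  have same: "vr s4 r_ans = vr s r_ans" "vr s4 r_k = vr s r_k" "vr s4 r_best = vr s r_best" "vr s3 r_c = vr s r_c"
    "ar s4 a_y = ar s a_y" "ar s4 a_cand = ar s2 a_cand" "vr s4 r_val = vr s3 r_val" "vr s4 r_bad = vr s2 r_bad"
    "vr s4 r_n = n"
    using prepD(1)[OF S] by (simp_all add: s4_def s3_def s2_def s1_def s0_def)
  have copy: "ar (exe copy_loop (t :: st)) a_y r = Y r"
    if "vr t r_n = n" "ar t a_cand = ar s2 a_cand" "r \<in> reps" for t r
    using copy_loop[OF that(1), of r] that cand reps_less by auto
  show "vr (exe body s) r_ans =
      (if clo (vr s r_c) (kept Y) \<and> n \<le> card (kept Y) + vr s r_k then 1 else vr s r_ans)"
    unfolding e update_def using f same val bad by auto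
  show "vr (exe body s) r_best = card (kept Y) \<and> (\<forall>r\<in>reps. ar (exe body s) a_y r = Y r)"
    if "clo (vr s r_c) (kept Y) \<and> patt (ar s a_w) Y \<and> vr s r_best < card (kept Y)"
    unfolding e update_def using that f same val bad copy by auto
  show "vr (exe body s) r_best = vr s r_best \<and> ar (exe body s) a_y = ar s a_y"
    if "\<not> (clo (vr s r_c) (kept Y) \<and> patt (ar s a_w) Y \<and> vr s r_best < card (kept Y))"
    unfolding e update_def using that f same val bad by auto
qed

section \<open>Soundness and completeness of the search\<close>

definition yes :: "nat \<Rightarrow> nat \<Rightarrow> bool" where
  "yes c k \<longleftrightarrow> (\<exists>K\<subseteq>{..<n}. clo c K \<and> n \<le> card K + k)"

definition sound :: "st \<Rightarrow> bool" where
  "sound s \<longleftrightarrow> vr s r_ans \<le> 1 \<and> (vr s r_ans = 1 \<longrightarrow> yes (vr s r_c) (vr s r_k))"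

definition feas :: "(nat \<Rightarrow> nat) \<Rightarrow> nat \<Rightarrow> nat \<Rightarrow> bool" where
  "feas w c k \<longleftrightarrow> (\<exists>ys. patt w ys \<and> clo c (kept ys) \<and> n \<le> card (kept ys) + k)"

definition valid :: "st \<Rightarrow> bool" where
  "valid s \<longleftrightarrow> patt (ar s a_w) (ar s a_y) \<and> clo (vr s r_c) (kept (ar s a_y)) \<and>
     vr s r_best \<le> card (kept (ar s a_y))"

lemma inner_sound:
  assumes S: "prep s" and "sound s"
  shows "sound (exe inner_loop s)"
proof -
  let ?I = "\<lambda>j t. sound t"
  have "?I (vr s r_N) (exe inner_loop s)"
    unfolding inner_loop_def
  proof (rule For_rule[where I = ?I], goal_cases)
    case 1
    then show ?case using assms(2) by (simp add: sound_def)
  next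
    case (2 j t)
    have St: "prep t" by (rule prep_frame[OF S]) (use 2 in auto)
    have jn: "vr t r_m < NN" using 2(1,2) prepD(2)[OF S] by simp
    have "yes (vr t r_c) (vr t r_k)"
      if "clo (vr t r_c) (kept (move (ar t a_y) (vr t r_m)))" "n \<le> card (kept (move (ar t a_y) (vr t r_m))) + vr t r_k"
      using that kept_sub unfolding yes_def by blast
    then show ?case using 2(3) body(1)[OF St jn] by (auto simp: sound_def)
  qed
  then show ?thesis .
qed

lemma inner_ans:
  assumes S: "prep s" and "vr s r_ans = 1"
  shows "vr (exe inner_loop s) r_ans = 1"
proof -
  let ?I = "\<lambda>j t. vr t r_ans = 1"
  have "?I (vr s r_N) (exe inner_loop s)"
    unfolding inner_loop_def
  proof (rule For_rule[where I = ?I], goal_cases)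
    case 1
    then show ?case using assms(2) by simp
  next
    case (2 j t)
    have St: "prep t" by (rule prep_frame[OF S]) (use 2 in auto)
    have jn: "vr t r_m < NN" using 2(1,2) prepD(2)[OF S] by simp
    show ?case using 2(3) body(1)[OF St jn] by auto
  qed
  then show ?thesis .
qed

text \<open>The current point may change in the middle of a pass, and later moves then start from
  the new point. This does no harm: while nothing has changed, the moves tried are moves of the
  original point, one of which hits by \<open>progress\<close>; after a change the recorded value
  has already risen, and it never falls.\<close>

lemma inner_progress:
  assumes S: "prep s" and v: "valid s" and fe: "feas (ar s a_w) (vr s r_c) (vr s r_k)"
  shows "vr (exe inner_loop s) r_ans = 1 \<or> valid (exe inner_loop s) \<and> vr s r_best < vr (exe inner_loop s) r_best"
proof -
  let ?Y = "\<lambda>q. move (ar s a_y) q"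
  let ?w = "ar s a_w" and ?c = "vr s r_c" and ?k = "vr s r_k" and ?\<beta> = "vr s r_best"
  define hit where "hit q \<longleftrightarrow> clo ?c (kept (?Y q)) \<and>
    (n \<le> card (kept (?Y q)) + ?k \<or> patt ?w (?Y q) \<and> ?\<beta> < card (kept (?Y q)))" for q
  let ?I = "\<lambda>j t. vr t r_ans = 1 \<or> valid t \<and> (?\<beta> < vr t r_best \<or>
    vr t r_best = ?\<beta> \<and> ar t a_y = ar s a_y \<and> (\<forall>q<j. \<not> hit q))"
  have "?I (vr s r_N) (exe inner_loop s)"
    unfolding inner_loop_def
  proof (rule For_rule[where I = ?I], goal_cases)
    case 1
    then show ?case using v by (simp add: valid_def)
  next
    case (2 j t)
    have St: "prep t" by (rule prep_frame[OF S]) (use 2 in auto)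
    have jn: "vr t r_m < NN" using 2(1,2) prepD(2)[OF S] by simp
    have fr: "ar t a_w = ?w" "vr t r_c = ?c" "vr t r_k = ?k" using 2 by auto
    note b = body[OF St jn, unfolded fr]
    let ?t = "exe body t" and ?Z = "move (ar t a_y) (vr t r_m)"
    have fr': "ar ?t a_w = ?w" "vr ?t r_c = ?c" using fr by auto
    have "vr ?t r_ans = 1 \<or> valid ?t \<and> (?\<beta> < vr ?t r_best \<or>
      vr ?t r_best = ?\<beta> \<and> ar ?t a_y = ar s a_y \<and> (\<forall>q<Suc j. \<not> hit q))"
    proof (cases "vr t r_ans = 1 \<or> clo ?c (kept ?Z) \<and> n \<le> card (kept ?Z) + ?k")
      case True
      then show ?thesis using b(1) by auto
    next
      case no: False
      then have I: "valid t" "?\<beta> < vr t r_best \<or>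
        vr t r_best = ?\<beta> \<and> ar t a_y = ar s a_y \<and> (\<forall>q<j. \<not> hit q)" using 2(3) by auto
      show ?thesis
      proof (cases "clo ?c (kept ?Z) \<and> patt ?w ?Z \<and> vr t r_best < card (kept ?Z)")
        case True
        have "vr ?t r_best = card (kept ?Z)" and y: "\<And>r. r \<in> reps \<Longrightarrow> ar ?t a_y r = ?Z r"
          using b(2)[OF True] by auto
        moreover have "kept (ar ?t a_y) = kept ?Z" "patt ?w (ar ?t a_y) = patt ?w ?Z"
          using kept_cong[of "ar ?t a_y" ?Z] patt_cong[of "ar ?t a_y" ?Z] y by auto
        moreover have "?\<beta> \<le> vr t r_best" using I(2) by auto
        ultimately have "valid ?t \<and> ?\<beta> < vr ?t r_best" using True fr' unfolding valid_def by auto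
        then show ?thesis by blast
      next
        case False
        have eq: "vr ?t r_best = vr t r_best" "ar ?t a_y = ar t a_y" using b(3)[OF False] by auto
        have "valid ?t" using I(1) eq fr fr' unfolding valid_def by auto
        moreover have "\<not> hit j" if "vr t r_best = ?\<beta>" "ar t a_y = ar s a_y"
          using that no False 2(2) unfolding hit_def by auto
        ultimately show ?thesis using I(2) eq by (auto simp: less_Suc_eq)
      qed
    qed
    then show ?case by (simp add: valid_def)
  qed
  moreover obtain ys where "patt ?w ys" "clo ?c (kept ys)" "n \<le> card (kept ys) + ?k" using fe unfolding feas_def by blast
  then have "\<exists>q<NN. hit q"
    using v unfolding hit_def valid_def by (intro progress) auto
  ultimately show ?thesis unfolding prepD(2)[OF S] by blast
qed

text \<open>After j passes without an answer the recorded value is at least j. As it is bounded by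
  the number of kept vertices and hence by n, there cannot be n + 1 such passes from a valid start
  whose pattern admits a solution.\<close>

lemma search_loop:
  assumes S: "prep s" and "sound s"
  shows "sound (exe search_loop s)" "vr s r_ans = 1 \<Longrightarrow> vr (exe search_loop s) r_ans = 1"
    "vr s r_n1 = n + 1 \<Longrightarrow> valid s \<Longrightarrow> feas (ar s a_w) (vr s r_c) (vr s r_k) \<Longrightarrow>
      vr (exe search_loop s) r_ans = 1"
proof -
  let ?P = "valid s \<and> feas (ar s a_w) (vr s r_c) (vr s r_k)"
  let ?I = "\<lambda>j t. sound t \<and> (vr s r_ans = 1 \<longrightarrow> vr t r_ans = 1) \<and> (?P \<longrightarrow> vr t r_ans = 1 \<or> valid t \<and> j \<le> vr t r_best)"
  have "?I (vr s r_n1) (exe search_loop s)"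
    unfolding search_loop_def
  proof (rule For_rule[where I = ?I], goal_cases)
    case 1
    then show ?case using assms(2) by (simp add: sound_def valid_def)
  next
    case (2 j t)
    have St: "prep t" by (rule prep_frame[OF S]) (use 2 in auto)
    have fr: "ar t a_w = ar s a_w" "vr t r_c = vr s r_c" "vr t r_k = vr s r_k" using 2 by auto
    have "vr (exe inner_loop t) r_ans = 1 \<or> valid (exe inner_loop t) \<and> Suc j \<le> vr (exe inner_loop t) r_best" if ?P
    proof (cases "vr t r_ans = 1")
      case True
      then show ?thesis using inner_ans[OF St] by blast
    next
      case False
      then have "valid t" "j \<le> vr t r_best" using 2(3) that by auto
      then show ?thesis using inner_progress[OF St] that fr by fastforce
    qed
    then show ?case using 2(3) inner_sound[OF St] inner_ans[OF St] by (simp add: sound_def valid_def)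
  qed
  then have I: "sound (exe search_loop s)" "vr s r_ans = 1 \<Longrightarrow> vr (exe search_loop s) r_ans = 1"
    "?P \<Longrightarrow> vr (exe search_loop s) r_ans = 1 \<or> valid (exe search_loop s) \<and> vr s r_n1 \<le> vr (exe search_loop s) r_best"
    by blast+
  show "sound (exe search_loop s)" "vr s r_ans = 1 \<Longrightarrow> vr (exe search_loop s) r_ans = 1" by fact+
  assume "vr s r_n1 = n + 1" "valid s" "feas (ar s a_w) (vr s r_c) (vr s r_k)"
  moreover have "card (kept (ar (exe search_loop s) a_y)) \<le> n"
    using card_mono[OF _ kept_sub] by fastforce
  ultimately show "vr (exe search_loop s) r_ans = 1" using I(3) unfolding valid_def by auto
qed

text \<open>Every digit string serves both as pattern and as starting point. Strings that are not
  closed or exceed a class size make bad starts but cannot do damage, since each reported answer has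
  its own certificate. Completeness needs one good string, and the truncated counts of a solution
  provide it.\<close>

lemma main_loop:
  assumes S: "prep s" and "vr s r_ans = 0" "vr s r_n1 = n + 1"
  shows "vr (exe main_loop s) r_ans = (if yes (vr s r_c) (vr s r_k) then 1 else 0)"
proof -
  let ?c = "vr s r_c" and ?k = "vr s r_k"
  let ?good = "\<lambda>q. patt (dg q) (dg q) \<and> clo ?c (kept (dg q)) \<and> feas (dg q) ?c ?k"
  let ?I = "\<lambda>j t. sound t \<and> ((\<exists>q<j. ?good q) \<longrightarrow> vr t r_ans = 1)"
  have "?I (vr s r_N) (exe main_loop s)"
    unfolding main_loop_def
  proof (rule For_rule[where I = ?I], goal_cases)
    case 1
    then show ?case using assms by (simp add: sound_def)
  next
    case (2 j t)
    have St: "prep t" by (rule prep_frame[OF S]) (use 2 in auto)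
    have jn: "j < NN" using 2(1) prepD(2)[OF S] by simp
    have fr: "vr t r_c = ?c" "vr t r_k = ?k" "vr t r_n1 = n + 1" using 2 assms(3) by auto
    define t0 where "t0 = set_var r_q j t"
    define t1 where "t1 = set_var r_best 0 (exe init_loop (exe dec_loop t0))"
    have T0: "prep t0" by (rule prep_frame[OF St]) (auto simp: t0_def)
    have T1: "prep t1" by (rule prep_frame[OF T0]) (auto simp: t1_def)
    have yw: "ar t1 a_y r = dg j r" "ar t1 a_w r = dg j r" if "r \<in> reps" for r
      using init_loop[of "exe dec_loop t0" r] dec_loop[OF T0 _ jn that] reps_less[OF that] prepD(1)[OF T0]
      by (simp_all add: t1_def) (simp_all add: t0_def)
    have fr1: "vr t1 r_c = ?c" "vr t1 r_k = ?k" "vr t1 r_n1 = n + 1" "vr t1 r_ans = vr t r_ans" "vr t1 r_best = 0"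
      using fr by (simp_all add: t1_def t0_def)
    have so: "sound t1" using 2(3) fr fr1 by (simp add: sound_def)
    have "vr (exe search_loop t1) r_ans = 1" if "?good j"
    proof (rule search_loop(3)[OF T1 so])
      have k: "kept (ar t1 a_y) = kept (dg j)" by (rule kept_cong) (use yw in auto)
      have p: "patt (ar t1 a_w) y = patt (dg j) y" for y by (rule patt_cong_left) (use yw in auto)
      have p': "patt w (ar t1 a_y) = patt w (dg j)" for w by (rule patt_cong) (use yw in auto)
      show "valid t1" using that fr1 k p p' by (simp add: valid_def)
      show "feas (ar t1 a_w) (vr t1 r_c) (vr t1 r_k)" using that fr1 p by (simp add: feas_def)
    qed (use fr1 in simp)
    moreover have "exe (Asg r_q (V r_w) ;; dec_loop ;; init_loop ;; Asg r_best (Cn 0) ;; search_loop) t = exe search_loop t1"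
      using 2(2) by (simp add: t1_def t0_def)
    ultimately show ?case using 2(3) search_loop(1,2)[OF T1 so] fr1(4)
      by (simp add: sound_def del: exe.simps) (metis less_Suc_eq)
  qed
  then have I: "sound (exe main_loop s)" "\<And>q. q < NN \<Longrightarrow> ?good q \<Longrightarrow> vr (exe main_loop s) r_ans = 1"
    unfolding prepD(2)[OF S] by blast+
  have fr: "vr (exe main_loop s) r_c = ?c" "vr (exe main_loop s) r_k = ?k"
    by (simp_all add: main_loop_def vr_exe)
  show ?thesis
  proof (cases "yes ?c ?k")
    case True
    then obtain K where K: "K \<subseteq> {..<n}" "clo ?c K" "n \<le> card K + ?k" unfolding yes_def by blast
    obtain w ys where w: "patt w ys" "clo ?c (kept ys)" "card (kept ys) = card K"
      "patt w w" "clo ?c (kept w)" "\<And>r. w r \<le> 2" using initial_pattern[OF K(1,2)] by blast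
    obtain q where q: "q < NN" "\<And>r. r \<in> reps \<Longrightarrow> dg q r = w r"
      using dg_surj[of w] w(6) bs_gt by (meson le_less_trans)
    have k: "kept (dg q) = kept w" by (rule kept_cong) (use q in auto)
    have p: "patt (dg q) y = patt w y" for y by (rule patt_cong_left) (use q in auto)
    have p': "patt w (dg q) = patt w w" by (rule patt_cong) (use q in auto)
    have "feas (dg q) ?c ?k" using w K(3) p unfolding feas_def by auto
    then have "?good q" using w k p p' by simp
    then show ?thesis using I(2)[OF q(1)] True by simp
  next
    case False
    then show ?thesis using I(1) fr by (auto simp: sound_def)
  qed
qed

end

section \<open>Sequences of phases\<close>

text \<open>A phase may not assign the bounds of its own loops, but it may assign those of later
  phases.\<close>

primrec compile_all :: "com list \<Rightarrow> prog" where
  "compile_all [] = compile Skip"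
| "compile_all (c # cs) = Seq (compile c) (compile_all cs)"

primrec bounded :: "com list \<Rightarrow> nat \<Rightarrow> st \<Rightarrow> bool" where
  "bounded [] X s = True"
| "bounded (c # cs) X s = ((\<forall>r \<in> set (lreg c). vr s r \<le> X) \<and> bounded cs X (exe c s))"

text \<open>\<open>X\<close> bounds the loop bounds of each phase in the state in which that phase
  starts. \<open>K\<close> and \<open>D\<close> again depend on the program text alone.\<close>

lemma runs_compile_all:
  assumes "list_all ok cs"
  shows "\<exists>K D. \<forall>X s. X \<ge> 1 \<and> bounded cs X s \<longrightarrow> runs (compile_all cs) s (K * X ^ D) (fold exe cs s)"
  using assms
proof (induction cs)
  case Nil
  have "runs (compile Skip) s (1 * X ^ 0) s" for X s
    using runs_comp[of Skip s] by simp
  then show ?case unfolding compile_all.simps fold_simps id_apply by blast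
next
  case (Cons c cs)
  obtain K D where 1: "\<And>X s. X \<ge> 1 \<Longrightarrow> bounded cs X s \<Longrightarrow> runs (compile_all cs) s (K * X ^ D) (fold exe cs s)"
    using Cons by auto
  obtain L E where 2: "\<And>\<beta> X. X \<ge> 1 \<Longrightarrow> \<forall>r \<in> set (lreg c). \<beta> r \<le> X \<Longrightarrow> cost \<beta> c \<le> L * X ^ E"
    using cost_polynomial[of c] by blast
  have mono: "runs P s T s' \<Longrightarrow> T \<le> U \<Longrightarrow> runs P s U s'" for P s T U s'
    unfolding runs_def by (meson order_trans)
  have "runs (compile_all (c # cs)) s ((L + K) * X ^ (E + D)) (fold exe (c # cs) s)"
    if X: "X \<ge> 1" and b: "bounded (c # cs) X s" for X s
  proof -
    have "runs (compile_all (c # cs)) s (cost (vr s) c + K * X ^ D) (fold exe (c # cs) s)"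
      using runs_Seq[OF runs_comp 1[OF X]] Cons.prems b by simp
    moreover have "cost (vr s) c \<le> L * X ^ E" using 2 X b by simp
    moreover have "L * X ^ E \<le> L * X ^ (E + D)" "K * X ^ D \<le> K * X ^ (E + D)"
      using X by (auto intro!: power_increasing)
    moreover have "(L + K) * X ^ (E + D) = L * X ^ (E + D) + K * X ^ (E + D)" by (rule add_mult_distrib)
    ultimately show ?thesis using mono by (metis (no_types, lifting) add_mono order_trans)
  qed
  then show ?case by blast
qed

lemma runs_compile_all_ex:
  assumes "list_all ok cs"
  shows "\<exists>T. runs (compile_all cs) s T (fold exe cs s)"
  using assms
proof (induction cs arbitrary: s)
  case Nil
  show ?case using runs_comp[of Skip s] by auto
next
  case (Cons c cs)
  then obtain T where "runs (compile_all cs) (exe c s) T (fold exe cs (exe c s))" by fastforce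
  then show ?case using runs_Seq[OF runs_comp[of c s]] Cons.prems by auto
qed

section \<open>The bound on the moves\<close>

definition pow2 :: "nat \<Rightarrow> nat \<Rightarrow> com" where
  "pow2 x y = Asg y (Cn 1) ;; For r_i x (Asg y (Pl (V y) (V y)))"

definition times :: "nat \<Rightarrow> nat \<Rightarrow> com" where
  "times x y = Asg r_m (Cn 0) ;; For r_x y (Asg r_m (Pl (V r_m) (V x))) ;; Asg x (V r_m)"

text \<open>Each power is a phase of its own because its result bounds the next loop, which
  \<open>ok\<close> excludes within one command. The last loop multiplies 1 by the base p times and
  yields the number of moves.\<close>

definition tower :: "com list" where
  "tower = [pow2 r_p r_t1, pow2 r_t1 r_t2, pow2 r_t2 r_g, Asg r_b (Pl (Pl (V r_g) (V r_g)) (Cn 1)) ;; Asg r_N (Cn 1),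
     For r_i r_p (times r_N r_b)]"

lemma assigned_arith [simp]:
  "asg (pow2 x y) = [y, r_i, y]" "sto (pow2 x y) = []" "lreg (pow2 x y) = [x]"
  "asg (times x y) = [r_m, r_x, r_m, x]" "sto (times x y) = []" "lreg (times x y) = [y]"
  by (simp_all add: pow2_def times_def)

lemma pow2:
  assumes "x \<noteq> y" "x \<noteq> r_i" "y \<noteq> r_i"
  shows "vr (exe (pow2 x y) s) y = 2 ^ vr s x"
proof -
  let ?s = "set_var y 1 s" and ?I = "\<lambda>j t. vr t y = 2 ^ j"
  have "?I (vr ?s x) (exe (For r_i x (Asg y (Pl (V y) (V y)))) ?s)"
    by (rule For_rule[where I = ?I]) (use assms in auto)
  then show ?thesis using assms by (simp add: pow2_def)
qed

lemma times:
  assumes "x \<noteq> r_m" "x \<noteq> r_x" "y \<noteq> r_m" "y \<noteq> r_x"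
  shows "vr (exe (times x y) s) x = vr s y * vr s x"
proof -
  let ?s = "set_var r_m 0 s" and ?I = "\<lambda>j t. vr t r_m = j * vr s x"
  have "?I (vr ?s y) (exe (For r_x y (Asg r_m (Pl (V r_m) (V x)))) ?s)"
    by (rule For_rule[where I = ?I]) (use assms in auto)
  then show ?thesis using assms by (simp add: times_def)
qed

lemma iterate_times:
  assumes "distinct [x, y, z, r_i, r_m, r_x]"
  shows "vr (exe (For r_i z (times x y)) s) x = vr s y ^ vr s z * vr s x"
proof -
  let ?I = "\<lambda>j t. vr t x = vr s y ^ j * vr s x"
  have "?I (vr s z) (exe (For r_i z (times x y)) s)"
    by (rule For_rule[where I = ?I]) (use assms times[of x y] in auto)
  then show ?thesis .
qed

lemma vr_For: "y \<noteq> x \<Longrightarrow> y \<notin> set (asg c) \<Longrightarrow> vr (exe (For x r c) s) y = vr s y"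
  by (rule vr_exe) simp

lemma ar_For: "a \<notin> set (sto c) \<Longrightarrow> ar (exe (For x r c) s) a = ar s a"
  by (rule ar_exe) simp

definition move_bound :: "nat \<Rightarrow> nat" where
  "move_bound p = 2 ^ 2 ^ 2 ^ p"

definition move_count :: "nat \<Rightarrow> nat" where
  "move_count p = (move_bound p + move_bound p + 1) ^ p"

text \<open>The sum of all stages of the tower. It dominates every loop bound that depends on the
  number of classes, and as a sum of register contents it is easy to compute.\<close>

definition size_bound :: "nat \<Rightarrow> nat" where
  "size_bound p = p + 2 ^ p + 2 ^ 2 ^ p + move_bound p + (move_bound p + move_bound p + 1) + move_count p + 1"

lemma tower:
  assumes "vr s r_p = p"
  shows "vr (fold exe tower s) r_t1 = 2 ^ p" "vr (fold exe tower s) r_t2 = 2 ^ 2 ^ p"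
    "vr (fold exe tower s) r_g = move_bound p"
    "vr (fold exe tower s) r_b = move_bound p + move_bound p + 1" "vr (fold exe tower s) r_N = move_count p"
    "\<And>y. y \<notin> {r_t1, r_t2, r_g, r_b, r_N, r_i, r_m, r_x} \<Longrightarrow> vr (fold exe tower s) y = vr s y"
    "ar (fold exe tower s) = ar s" "inp (fold exe tower s) = inp s"
    "size_bound p \<le> X \<Longrightarrow> bounded tower X s"
proof -
  have "ar (fold exe tower s) a = ar s a" for a
    by (simp add: tower_def ar_For)
  then show "ar (fold exe tower s) = ar s" by blast
qed (use assms in \<open>auto simp: tower_def pow2 iterate_times vr_For move_bound_def move_count_def size_bound_def\<close>)

lemma ok_tower: "list_all ok tower"
  by (simp add: tower_def pow2_def times_def)

text \<open>The tower is rerun with the argument in place of the number of classes, so the bound is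
  computed by the means of the algorithm itself. The final loop multiplies \<open>K\<close> by the
  size bound \<open>D\<close> times, with \<open>r_k\<close> as accumulator.\<close>

definition bound_phases :: "nat \<Rightarrow> nat \<Rightarrow> com list" where
  "bound_phases K D = Asg r_p (V 0) # tower @
     [Asg r_s (Pl (Pl (Pl (Pl (Pl (Pl (V r_p) (V r_t1)) (V r_t2)) (V r_g)) (V r_b)) (V r_N)) (Cn 1)) ;;
        Asg r_h (Cn D) ;; Asg r_k (Cn K),
      For r_i r_h (times r_k r_s), Asg 0 (V r_k)]"

lemma computable_bound: "computable (\<lambda>p. K * size_bound p ^ D)"
  unfolding computable_def
proof (intro exI[of _ "compile_all (bound_phases K D)"] allI)
  fix x
  let ?\<sigma> = "\<lparr>regs = (\<lambda>_. 0)(0 := x), mem = (\<lambda>_. 0)\<rparr>"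
  let ?s = "\<lparr>vr = (\<lambda>_. 0)(0 := x), ar = (\<lambda>_ _. 0), inp = (\<lambda>_. 0)\<rparr>"
  have "list_all ok (bound_phases K D)" using ok_tower by (simp add: bound_phases_def times_def)
  then obtain T where "runs (compile_all (bound_phases K D)) ?s T (fold exe (bound_phases K D) ?s)"
    using runs_compile_all_ex by blast
  moreover have "refines ?s ?\<sigma>" by (simp add: refines_def)
  ultimately obtain t \<sigma>' where 1: "exec (compile_all (bound_phases K D)) ?\<sigma> t \<sigma>'"
    "refines (fold exe (bound_phases K D) ?s) \<sigma>'" unfolding runs_def by blast
  have "vr (fold exe (bound_phases K D) ?s) 0 = K * size_bound x ^ D"
    using tower[of "set_var r_p x ?s" x] by (simp add: bound_phases_def iterate_times vr_For size_bound_def)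
  then have "regs \<sigma>' 0 = K * size_bound x ^ D" using 1(2) by (simp add: refines_def)
  then show "\<exists>t s'. exec (compile_all (bound_phases K D)) ?\<sigma> t s' \<and> regs s' 0 = K * size_bound x ^ D"
    using 1(1) by blast
qed

section \<open>The complete algorithm\<close>

definition phases :: "com list" where
  "phases = [rep_all, rank_all] @ tower @ [Asg r_n1 (Pl (V r_n) (Cn 1)) ;; Asg r_ans (Cn 0), main_loop, Asg 0 (V r_ans)]"

lemma ok_phases: "list_all ok phases"
  using ok_tower
  by (simp add: phases_def rep_all_def rep_loop_def tw_loop_def rank_all_def rank_loop_def main_loop_def
      dec_loop_def div_loop_def init_loop_def search_loop_def inner_loop_def body_def cand_loop_def keep_loop_def
      closed_loop_def row_loop_def count_loop_def update_def copy_loop_def)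

lemma bounded_append: "bounded (cs @ ds) X s \<longleftrightarrow> bounded cs X s \<and> bounded ds X (fold exe cs s)"
  by (induction cs arbitrary: s) auto

lemma lreg_phases:
  "set (lreg rep_all) = {r_n}" "set (lreg rank_all) = {r_n}" "set (lreg main_loop) = {r_n, r_N, r_n1}"
  by (auto simp: rep_all_def rep_loop_def tw_loop_def rank_all_def rank_loop_def main_loop_def
      dec_loop_def div_loop_def init_loop_def search_loop_def inner_loop_def body_def cand_loop_def keep_loop_def
      closed_loop_def row_loop_def count_loop_def update_def copy_loop_def)

context twin_graph
begin

text \<open>Loop bounds are of two kinds, at most n + 1 or a function of the number of classes, and
  the product of the two estimates dominates both. A power of this product later separates into the
  two required factors.\<close>

lemma phases:
  assumes G: "graph_in s" and z: "vr s r_vn = 0" "vr s r_p = 0"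
  shows "vr (fold exe phases s) 0 = (if yes (vr s r_c) (vr s r_k) then 1 else 0)"
    "bounded phases (size_bound (card reps) * (n + 1)) s"
proof -
  have n: "vr s r_n = n" using G by (simp add: graph_in_def)
  define s1 where "s1 = exe rep_all s"
  define s2 where "s2 = exe rank_all s1"
  define s3 where "s3 = fold exe tower s2"
  define s4 where "s4 = set_var r_ans 0 (set_var r_n1 (n + 1) s3)"
  let ?X = "size_bound (card reps) * (n + 1)"
  have f1: "vr s1 x = vr s x" if "x \<notin> {r_v, r_un, r_cnt, r_u, r_f, r_x, r_vn}" for x
    unfolding s1_def rep_all_def using that by (simp add: vr_For)
  have f2: "vr s2 x = vr s1 x" if "x \<notin> {r_v, r_s, r_cnt, r_u, r_p}" for x
    unfolding s2_def rank_all_def using that by (simp add: vr_For)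
  have r1: "ar s1 a_rep v = rp v" if "v < n" for v using rep_all[OF G z(1) that] by (simp add: s1_def)
  have r2: "ar s2 a_rep = ar s1 a_rep" unfolding s2_def rank_all_def by (simp add: ar_For)
  have n1: "vr s1 r_n = n" "vr s1 r_p = 0" using f1 n z by auto
  have ra: "v < n \<Longrightarrow> ar s2 a_rank v = rk v" "v < n \<Longrightarrow> ar s2 a_sz v = sz (rp v)" "vr s2 r_p = card reps" for v
    using rank_all[OF n1 r1] by (auto simp: s2_def)
  note tw = tower[OF ra(3), folded s3_def]
  have f: "vr s4 r_n = n" "vr s4 r_c = vr s r_c" "vr s4 r_k = vr s r_k" "vr s3 r_n = n"
    using tw(6) f1 f2 n by (auto simp: s4_def)
  have i: "inp s4 = inp s" using tw(8) by (simp add: s4_def s2_def s1_def)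
  have P: "prep s4"
    unfolding prep_def graph_in_def
    using G f i r1 r2 ra tw by (simp add: s4_def graph_in_def NN_def bs_def bd_def move_bound_def move_count_def)
  have e: "fold exe phases s = set_var 0 (vr (exe main_loop s4) r_ans) (exe main_loop s4)"
    using f(4) by (simp add: phases_def s1_def[symmetric] s2_def[symmetric] s3_def[symmetric] s4_def)
  have "vr (exe main_loop s4) r_ans = (if yes (vr s4 r_c) (vr s4 r_k) then 1 else 0)"
    by (rule main_loop[OF P]) (simp_all add: s4_def)
  then show "vr (fold exe phases s) 0 = (if yes (vr s r_c) (vr s r_k) then 1 else 0)"
    using e f by simp
  have X: "size_bound (card reps) \<le> ?X" "n + 1 \<le> ?X" by (simp_all add: size_bound_def)
  have "move_count (card reps) \<le> size_bound (card reps)" by (simp add: size_bound_def)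
  then have "vr s4 r_N \<le> ?X" "vr s4 r_n1 \<le> ?X" using X tw(5) by (simp_all add: s4_def)
  moreover have "bounded tower ?X s2" using tw(9) X by blast
  ultimately show "bounded phases ?X s"
    unfolding phases_def using f X n n1 lreg_phases
    by (simp add: bounded_append s1_def[symmetric] s2_def[symmetric] s3_def[symmetric])
      (simp add: s4_def)
qed

end

section \<open>Input graphs\<close>

lemma twin_graph_of:
  assumes "simple_graph G" "verts G = {..<n}"
  shows "twin_graph n (\<lambda>u v. {u, v} \<in> edges G)"
proof
  have e: "u < n \<and> v < n \<and> u \<noteq> v" if "{u, v} \<in> edges G" for u v
    using that assms by (auto simp: simple_graph_def doubleton_eq_iff)
  show "{u, v} \<in> edges G \<Longrightarrow> {v, u} \<in> edges G" for u v by (simp add: insert_commute)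
  show "{u, u} \<notin> edges G" for u using e by blast
  show "{u, v} \<in> edges G \<Longrightarrow> u < n \<and> v < n" for u v using e by blast
qed

text \<open>No vertex is its own neighbour, so removing each of two vertices from the neighbourhood
  of the other amounts to ignoring both in the comparison, as \<open>tw\<close> does.\<close>

lemma card_reps_eq_nd:
  assumes G: "simple_graph G" "verts G = {..<n}"
  shows "card (twin_graph.reps n (\<lambda>u v. {u, v} \<in> edges G)) = nd G"
proof -
  interpret twin_graph n "\<lambda>u v. {u, v} \<in> edges G" by (rule twin_graph_of[OF G])
  have st: "(u, v) \<in> same_type G \<longleftrightarrow> u < n \<and> v < n \<and> tw u v" for u v
  proof -
    have nb: "x \<in> nbhd G w \<longleftrightarrow> x < n \<and> {w, x} \<in> edges G" for x w
      using G(2) by (simp add: nbhd_def insert_commute)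
    have "nbhd G u - {v} = nbhd G v - {u} \<longleftrightarrow> tw u v"
      unfolding set_eq_iff Diff_iff nb tw_def singleton_iff using adj_irrefl by blast
    then show ?thesis using G(2) by (simp add: same_type_def)
  qed
  have im: "same_type G `` {v} = cl (rp v)" if "v < n" for v
    using that rp_eq_iff[of _ v] tw_sym by (auto simp: st cl_def)
  have "verts G // same_type G = cl ` reps"
  proof
    show "verts G // same_type G \<subseteq> cl ` reps"
      using im rp_reps G(2) by (auto simp: quotient_def)
    show "cl ` reps \<subseteq> verts G // same_type G"
    proof
      fix C assume "C \<in> cl ` reps"
      then obtain r where "r < n" "rp r = r" "C = cl r" by (auto simp: reps_def)
      then have "C = same_type G `` {r}" "r \<in> verts G" using im[of r] G(2) by auto
      then show "C \<in> verts G // same_type G" by (auto simp: quotient_def)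
    qed
  qed
  moreover have "inj_on cl reps"
  proof (rule inj_onI)
    fix q r assume "q \<in> reps" "r \<in> reps" "cl q = cl r"
    have "q \<in> cl q" "rp q = q" using \<open>q \<in> reps\<close> by (simp_all add: reps_def cl_def)
    then have "rp q = r" unfolding \<open>cl q = cl r\<close> by (simp add: cl_def)
    then show "q = r" using \<open>rp q = q\<close> by simp
  qed
  ultimately show ?thesis unfolding nd_def by (simp add: card_image)
qed

text \<open>Deleted and kept sets are complements. Positivity of c makes \<open>\<le> c - 1\<close>
  the same as \<open>< c\<close> under truncated subtraction.\<close>

lemma yes_iff_deletion:
  assumes G: "simple_graph G" "verts G = {..<n}" and c: "c \<ge> 1"
  shows "twin_graph.yes n (\<lambda>u v. {u, v} \<in> edges G) c k \<longleftrightarrow> c_closed_vertex_deletion c G k"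
proof -
  interpret twin_graph n "\<lambda>u v. {u, v} \<in> edges G" by (rule twin_graph_of[OF G])
  have clo: "c_closed c (delete_verts G S) \<longleftrightarrow> clo c ({..<n} - S)" for S
  proof -
    let ?H = "delete_verts G S"
    have V: "verts ?H = {..<n} - S" using G(2) by (simp add: delete_verts_def)
    have E: "{u, v} \<in> edges ?H \<longleftrightarrow> {u, v} \<in> edges G" if "u \<in> {..<n} - S" "v \<in> {..<n} - S" for u v
      using that by (simp add: delete_verts_def)
    have N: "nbhd ?H u \<inter> nbhd ?H v = {x \<in> {..<n} - S. {u, x} \<in> edges G \<and> {v, x} \<in> edges G}"
      if "u \<in> {..<n} - S" "v \<in> {..<n} - S" for u v
      using E that unfolding nbhd_def V by (auto simp: insert_commute)
    have L: "m \<le> c - 1 \<longleftrightarrow> m < c" for m using c by auto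
    show ?thesis unfolding c_closed_def clo_def V using E N L by auto
  qed
  show ?thesis
  proof
    assume "yes c k"
    then obtain K where K: "K \<subseteq> {..<n}" "clo c K" "n \<le> card K + k" unfolding yes_def by blast
    have "{..<n} - ({..<n} - K) = K" using K(1) by blast
    moreover have "card ({..<n} - K) \<le> k"
      using K card_Diff_subset[of K "{..<n}"] finite_subset[OF K(1)] by simp
    ultimately show "c_closed_vertex_deletion c G k"
      unfolding c_closed_vertex_deletion_def using clo[of "{..<n} - K"] K(2) G(2)
      by (intro exI[of _ "{..<n} - K"]) auto
  next
    assume "c_closed_vertex_deletion c G k"
    then obtain S where S: "S \<subseteq> {..<n}" "card S \<le> k" "c_closed c (delete_verts G S)"
      unfolding c_closed_vertex_deletion_def using G(2) by auto
    have "n \<le> card ({..<n} - S) + k"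
      using S card_Diff_subset[of S "{..<n}"] finite_subset[OF S(1)] by simp
    then show "yes c k" unfolding yes_def using clo S by (intro exI[of _ "{..<n} - S"]) auto
  qed
qed

section \<open>Setting up the memory layout\<close>

definition square_loop :: prog where
  "square_loop = WhileNZ 30 (Seq (Instr (Add 3 3 0)) (Instr (Sub 30 30 31)))"

text \<open>Written in machine code, because compiled programs presuppose the array base n * n in
  register 3 and cannot set it. The addition copies n to register 30, as register 3 is still 0. The
  constant c enters the program text only here.\<close>

definition prologue :: "nat \<Rightarrow> prog" where
  "prologue c = Seq (Instr (Const 2 c)) (Seq (Instr (Const 31 1)) (Seq (Instr (Add 30 0 3)) square_loop))"

lemma square_loop:
  assumes "regs \<sigma> 31 = 1"
  shows "\<exists>\<sigma>'. exec square_loop \<sigma> (3 * regs \<sigma> 30 + 1) \<sigma>' \<and> mem \<sigma>' = mem \<sigma> \<and>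
    regs \<sigma>' 3 = regs \<sigma> 3 + regs \<sigma> 30 * regs \<sigma> 0 \<and> (\<forall>i<30. i \<noteq> 3 \<longrightarrow> regs \<sigma>' i = regs \<sigma> i)"
  using assms
proof (induction "regs \<sigma> 30" arbitrary: \<sigma>)
  case 0
  then show ?case using exec.WhileFalse[of \<sigma> 30] unfolding square_loop_def by (intro exI[of _ \<sigma>]) simp
next
  case (Suc m)
  let ?\<sigma> = "step (Sub 30 30 31) (step (Add 3 3 0) \<sigma>)"
  have m: "m = regs ?\<sigma> 30" "regs ?\<sigma> 31 = 1" using Suc.hyps(2) Suc.prems by auto
  obtain \<sigma>' where 1: "exec square_loop ?\<sigma> (3 * regs ?\<sigma> 30 + 1) \<sigma>'" "mem \<sigma>' = mem ?\<sigma>"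
    "regs \<sigma>' 3 = regs ?\<sigma> 3 + regs ?\<sigma> 30 * regs ?\<sigma> 0" "\<forall>i<30. i \<noteq> 3 \<longrightarrow> regs \<sigma>' i = regs ?\<sigma> i"
    using Suc.hyps(1)[OF m] by blast
  have "exec square_loop \<sigma> (1 + 1 + (3 * regs ?\<sigma> 30 + 1) + 1) \<sigma>'"
    unfolding square_loop_def
    by (rule exec.WhileTrue[OF _ exec.Seq[OF exec.Instr exec.Instr] 1(1)[unfolded square_loop_def]])
      (use Suc.hyps(2) in simp)
  moreover have "1 + 1 + (3 * regs ?\<sigma> 30 + 1) + 1 = 3 * regs \<sigma> 30 + 1"
    using m(1) Suc.hyps(2) by simp
  moreover have "regs \<sigma>' 3 = regs \<sigma> 3 + regs \<sigma> 30 * regs \<sigma> 0"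
  proof -
    have "regs ?\<sigma> 3 = regs \<sigma> 3 + regs \<sigma> 0" "regs ?\<sigma> 0 = regs \<sigma> 0" by simp_all
    then show ?thesis using 1(3) unfolding m(1)[symmetric] Suc.hyps(2)[symmetric] by simp
  qed
  ultimately show ?case using 1(2,4) by (intro exI[of _ \<sigma>']) auto
qed

text \<open>All cells from n * n on are initially 0, so the arrays start as zero, and the cells
  below n * n are the adjacency matrix.\<close>

lemma prologue:
  fixes n k c :: nat
  assumes "verts G = {..<n}"
  defines "s \<equiv> \<lparr>vr = (\<lambda>_. 0)(0 := n, 1 := k, 2 := c, 3 := n * n), ar = (\<lambda>_ _. 0), inp = mem (input_state G k)\<rparr>"
  shows "\<exists>\<sigma>. exec (prologue c) (input_state G k) (3 * n + 4) \<sigma> \<and> refines s \<sigma>"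
proof -
  let ?\<sigma> = "step (Add 30 0 3) (step (Const 31 1) (step (Const 2 c) (input_state G k)))"
  have n: "card (verts G) = n" using assms(1) by simp
  have r: "regs ?\<sigma> 31 = 1" "regs ?\<sigma> 30 = n" "regs ?\<sigma> 3 = 0" "regs ?\<sigma> 0 = n" "mem ?\<sigma> = mem (input_state G k)"
    "\<forall>i<30. i \<noteq> 3 \<longrightarrow> regs ?\<sigma> i = ((\<lambda>_. 0)(0 := n, 1 := k, 2 := c)) i"
    using n by (auto simp: input_state_def Let_def)
  obtain \<sigma>' where 1: "exec square_loop ?\<sigma> (3 * n + 1) \<sigma>'" "mem \<sigma>' = mem (input_state G k)"
    "regs \<sigma>' 3 = n * n" "\<forall>i<30. i \<noteq> 3 \<longrightarrow> regs \<sigma>' i = ((\<lambda>_. 0)(0 := n, 1 := k, 2 := c)) i"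
    using square_loop[OF r(1)] r by auto
  have "exec (prologue c) (input_state G k) (1 + (1 + (1 + (3 * n + 1)))) \<sigma>'"
    unfolding prologue_def by (rule exec.Seq[OF exec.Instr exec.Seq[OF exec.Instr exec.Seq[OF exec.Instr 1(1)]]])
  moreover have "refines s \<sigma>'"
    using 1 n by (auto simp: refines_def s_def input_state_def Let_def)
  moreover have "1 + (1 + (1 + (3 * n + 1))) = 3 * n + 4" by simp
  ultimately show ?thesis by metis
qed

text \<open>\<open>f\<close> and \<open>d\<close> can be fixed before c because the phases are the
  same program for every c.\<close>

theorem theorem8:
  shows "\<exists>(f :: nat \<Rightarrow> nat) (d :: nat). computable f \<and>
    (\<forall>c\<ge>1. \<exists>P. solves_CVD_within c P (\<lambda>G. f (nd G) * (card (verts G) + 1) ^ d))"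
proof -
  obtain K D where KD: "\<And>X s. X \<ge> 1 \<Longrightarrow> bounded phases X s \<Longrightarrow>
    runs (compile_all phases) s (K * X ^ D) (fold exe phases s)"
    using runs_compile_all[OF ok_phases] by blast
  let ?f = "\<lambda>p. (K + 4) * size_bound p ^ Suc D"
  have "solves_CVD_within c (Seq (prologue c) (compile_all phases))
      (\<lambda>G. ?f (nd G) * (card (verts G) + 1) ^ Suc D)" if c: "c \<ge> 1" for c
    unfolding solves_CVD_within_def
  proof (intro allI impI, elim conjE)
    fix G :: "nat ugraph" and k
    assume G: "simple_graph G" "verts G = {..<card (verts G)}"
    define n where "n = card (verts G)"
    have V: "verts G = {..<n}" using G(2) by (simp add: n_def)
    interpret twin_graph n "\<lambda>u v. {u, v} \<in> edges G" by (rule twin_graph_of[OF G(1) V])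
    let ?X = "size_bound (nd G) * (n + 1)"
    define s where "s = \<lparr>vr = (\<lambda>_. 0)(0 := n, 1 := k, 2 := c, 3 := n * n), ar = (\<lambda>_ _. 0), inp = mem (input_state G k)\<rparr>"
    obtain \<sigma> where \<sigma>: "exec (prologue c) (input_state G k) (3 * n + 4) \<sigma>" "refines s \<sigma>"
      using prologue[OF V] unfolding s_def by blast
    have p: "card reps = nd G" by (rule card_reps_eq_nd[OF G(1) V])
    \<comment> \<open>The cell lies below n * n, hence inside the matrix, and division by n recovers
      \<open>u\<close> and \<open>v\<close>.\<close>
    have "inp s (u * n + v) = (if {u, v} \<in> edges G then 1 else 0)" if "u < n" "v < n" for u v
    proof -
      have "u * n + v < Suc u * n" using that by simp
      also have "\<dots> \<le> n * n" by (rule mult_le_mono1) (use that in simp)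
      finally show ?thesis using that by (simp add: s_def input_state_def Let_def n_def[symmetric])
    qed
    then have gi: "graph_in s" by (simp add: graph_in_def s_def)
    have z: "vr s r_vn = 0" "vr s r_p = 0" by (simp_all add: s_def)
    have X: "?X \<ge> 1" by (simp add: size_bound_def)
    have "runs (compile_all phases) s (K * ?X ^ D) (fold exe phases s)"
      using KD[OF X] phases(2)[OF gi z] p by simp
    then obtain t \<sigma>' where 2: "exec (compile_all phases) \<sigma> t \<sigma>'" "t \<le> K * ?X ^ D" "refines (fold exe phases s) \<sigma>'"
      using \<sigma>(2) unfolding runs_def by blast
    have "regs \<sigma>' 0 = vr (fold exe phases s) 0" using 2(3) by (simp add: refines_def)
    also have "\<dots> = (if yes c k then 1 else 0)" using phases(1)[OF gi z] by (simp add: s_def)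
    also have "\<dots> = (if c_closed_vertex_deletion c G k then 1 else 0)"
      using yes_iff_deletion[OF G(1) V c] by simp
    finally have ans: "regs \<sigma>' 0 = (if c_closed_vertex_deletion c G k then 1 else 0)" .
    \<comment> \<open>The prologue takes at most 4 * \<open>?X\<close> steps, which is the origin of
      the 4 in \<open>?f\<close>. The exponent \<open>Suc D\<close> makes room for it even if
      \<open>D\<close> is 0.\<close>
    have "3 * n + 4 + t \<le> 4 * ?X ^ Suc D + K * ?X ^ Suc D"
    proof (rule add_mono)
      have "n + 1 \<le> ?X" by (simp add: size_bound_def)
      also have "\<dots> \<le> ?X ^ Suc D" by (rule self_le_power[OF X]) simp
      finally show "3 * n + 4 \<le> 4 * ?X ^ Suc D" by linarith
      have "K * ?X ^ D \<le> K * ?X ^ Suc D" by (intro mult_le_mono2 power_increasing X) simp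
      then show "t \<le> K * ?X ^ Suc D" using 2(2) by linarith
    qed
    also have "\<dots> = ?f (nd G) * (n + 1) ^ Suc D"
      unfolding power_mult_distrib by (simp only: algebra_simps)
    finally have "3 * n + 4 + t \<le> ?f (nd G) * (card (verts G) + 1) ^ Suc D" by (simp only: n_def)
    then show "\<exists>t s'. exec (Seq (prologue c) (compile_all phases)) (input_state G k) t s' \<and>
        t \<le> ?f (nd G) * (card (verts G) + 1) ^ Suc D \<and>
        regs s' 0 = (if c_closed_vertex_deletion c G k then 1 else 0)"
      using exec.Seq[OF \<sigma>(1) 2(1)] ans by blast
  qed
  then show ?thesis using computable_bound[of "K + 4" "Suc D"] by blast
qed

end
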